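(* Let $\eta_i=\eta_i(R^i)$, $i=1,\dots,n$, be functions with $\eta_i\ne\eta_j$ for $i\neq j$, let $H_i(R^1,\dots,R^n)>0$ and $\beta_{ij}$ ($i\neq j$) be functions with $\partial_iH_j=\beta_{ij}H_i$ for $i\ne j$, and suppose that $$\partial_k\beta_{ij}=\beta_{ik}\beta_{kj}\quad(i,j,k\text{ pairwise distinct}),$$ $$\partial_i\beta_{ij}=\frac12\frac{\eta_i'}{\eta_j-\eta_i}\beta_{ij}+\frac12\frac{\eta_j'}{\eta_j-\eta_i}\beta_{ji}+\sum_{k\neq i,j}\frac{\eta_k-\eta_j}{\eta_j-\eta_i}\beta_{ki}\beta_{kj}\quad(i\neq j).$$ Then, locally, for every $\lambda$ with $\lambda+\eta_i>0$ for all $i$, there exist an orthonormal frame $\vec\varphi_1,\dots,\vec\varphi_n$ in Euclidean space $E^n$, depending on $R=(R^1,\dots,R^n)$, and a vector $\vec r(R)\in E^n$ such that $$\partial_j\vec\varphi_i=\sqrt{\frac{\lambda+\eta_i}{\lambda+\eta_j}}\,\beta_{ij}\vec\varphi_j\ (j\neq i),\qquad \partial_i\vec\varphi_i=-\sum_{k\neq i}\sqrt{\frac{\lambda+\eta_k}{\lambda+\eta_i}}\,\beta_{ki}\vec\varphi_k,\qquad \partial_i\vec r=\frac{H_i}{\sqrt{\lambda+\eta_i}}\vec\varphi_i ,$$ so that $\vec r$ defines an $n$-orthogonal coordinate system in $E^n$ corresponding to the flat metric $\sum_i\frac{H_i^2}{\lambda+\eta_i}(dR^i)^2$. As $\lambda$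 varies, the Weingarten operator of each coordinate hypersurface is preserved up to a constant scaling factor: for each $m$, on the hypersurface $R^m=\mathrm{const}$ with unit normal $\vec\varphi_m$ one has $$\partial_i\vec\varphi_m=\frac{\beta_{mi}}{H_i}\sqrt{\lambda+\eta_m}\;\partial_i\vec r\qquad(i\neq m),$$ so its principal curvatures are $k^i=\frac{\beta_{mi}}{H_i}\sqrt{\lambda+\eta_m}$, where $\eta_m$ is constant on the hypersurface, and $R^i$ ($i\ne m$) are curvature line coordinates for every $\lambda$.
   Context: Here $\partial_i=\partial/\partial R^i$, $\eta_i'=d\eta_i/dR^i$, and there is no summation over repeated indices except where a sum is written. The Weingarten operator of a hypersurface with radius-vector $\vec r$ and unit normal $\vec n$ is taken with the sign convention $d\vec n=W(d\vec r)$; in the curvature line coordinates $R^i$ it is diagonal with entries the principal curvatures $k^i$, $\partial_i\vec n=k^i\partial_i\vec r$. An $n$-orthogonal coordinate system is one whose coordinate lines are mutually orthogonal. *)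

theory Defs
  imports "HOL-Analysis.Analysis"
begin

text \<open>Functions of class \<open>C^k\<close> and \<open>C^\<infinity>\<close>. These notions are only used on open sets.\<close>

primrec Ck_on :: "nat \<Rightarrow> 'a::real_normed_vector set \<Rightarrow> ('a \<Rightarrow> 'b::real_normed_vector) \<Rightarrow> bool" where
  "Ck_on 0 S f \<longleftrightarrow> continuous_on S f"
| "Ck_on (Suc k) S f \<longleftrightarrow>
     (\<forall>x\<in>S. f differentiable (at x)) \<and> (\<forall>v. Ck_on k S (\<lambda>x. frechet_derivative f (at x) v))"

definition smooth_on :: "'a::real_normed_vector set \<Rightarrow> ('a \<Rightarrow> 'b::real_normed_vector) \<Rightarrow> bool" where
  "smooth_on S f \<longleftrightarrow> (\<forall>k. Ck_on k S f)"

text \<open>The partial derivative of \<open>f\<close> with respect to the \<open>i\<close>-th coordinate, at \<open>R\<close>.\<close>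

definition pd :: "'n::finite \<Rightarrow> (real^'n \<Rightarrow> 'b::real_normed_vector) \<Rightarrow> real^'n \<Rightarrow> 'b" where
  "pd i f R = frechet_derivative f (at R) (axis i 1)"

definition orthonormal_frame :: "('n::finite \<Rightarrow> real^'n) \<Rightarrow> bool" where
  "orthonormal_frame e \<longleftrightarrow> (\<forall>i j. e i \<bullet> e j = (if i = j then 1 else 0))"

text \<open>Curvilinear coordinates in Euclidean space, given by the radius-vector \<open>r\<close> as a function of
  the coordinates. As usual for curvilinear coordinates this is a local notion: \<open>r\<close> is a smooth map
  that is, near each point, injective with invertible differential (hence, by the inverse
  function theorem, a diffeomorphism onto an open set).\<close>

definition coordinate_system_on :: "(real^'n::finite) set \<Rightarrow> (real^'n \<Rightarrow> real^'n) \<Rightarrow> bool" where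
  "coordinate_system_on V r \<longleftrightarrow>
     smooth_on V r \<and>
     (\<forall>x\<in>V. bij (frechet_derivative r (at x)) \<and>
            (\<exists>N. open N \<and> x \<in> N \<and> N \<subseteq> V \<and> inj_on r N))"

definition orthogonal_coordinate_system_on ::
    "(real^'n::finite) set \<Rightarrow> (real^'n \<Rightarrow> real^'n) \<Rightarrow> bool" where
  "orthogonal_coordinate_system_on V r \<longleftrightarrow>
     coordinate_system_on V r \<and>
     (\<forall>R\<in>V. \<forall>i j. i \<noteq> j \<longrightarrow> pd i r R \<bullet> pd j r R = 0)"

text \<open>The components of the Euclidean metric in the coordinates given by \<open>r\<close>.\<close>

definition metric_of :: "(real^'n::finite \<Rightarrow> real^'n) \<Rightarrow> real^'n \<Rightarrow> 'n \<Rightarrow> 'n \<Rightarrow> real" where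
  "metric_of r R i j = pd i r R \<bullet> pd j r R"

text \<open>A metric is flat if it is locally isometric to the Euclidean metric.\<close>

definition flat_metric_on :: "(real^'n::finite) set \<Rightarrow> (real^'n \<Rightarrow> 'n \<Rightarrow> 'n \<Rightarrow> real) \<Rightarrow> bool" where
  "flat_metric_on V g \<longleftrightarrow>
     (\<forall>x\<in>V. \<exists>N y. open N \<and> x \<in> N \<and> N \<subseteq> V \<and> coordinate_system_on N y \<and>
                    (\<forall>R\<in>N. \<forall>i j. g R i j = metric_of y R i j))"

text \<open>The coordinate hypersurface \<open>R$m = const\<close> through the point \<open>R\<close>: its tangent space at
  \<open>R\<close>, as a subspace of Euclidean space. In the space of the coordinates, the tangent vectors of the
  hypersurface are the \<open>v\<close> with \<open>v$m = 0\<close>.\<close>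

definition hypersurface_tangent :: "(real^'n::finite \<Rightarrow> real^'n) \<Rightarrow> 'n \<Rightarrow> real^'n \<Rightarrow> (real^'n) set" where
  "hypersurface_tangent r m R = frechet_derivative r (at R) ` {v. v $ m = 0}"

text \<open>\<open>\<nu>\<close> is a field of unit normals of the hypersurfaces \<open>R$m = const\<close>.\<close>

definition unit_normal_on ::
    "(real^'n::finite) set \<Rightarrow> (real^'n \<Rightarrow> real^'n) \<Rightarrow> 'n \<Rightarrow> (real^'n \<Rightarrow> real^'n) \<Rightarrow> bool" where
  "unit_normal_on V r m \<nu> \<longleftrightarrow>
     (\<forall>R\<in>V. norm (\<nu> R) = 1 \<and> (\<forall>t\<in>hypersurface_tangent r m R. \<nu> R \<bullet> t = 0))"

text \<open>\<open>W\<close> is the Weingarten operator, at \<open>R\<close>, of the hypersurface \<open>R$m = const\<close> with unit normal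
  \<open>\<nu>\<close>: the endomorphism of the tangent space with \<open>d\<nu> = W(dr)\<close> along the hypersurface. It is
  represented by its extension to the whole space which vanishes on the normal, so that it is
  uniquely determined.\<close>

definition weingarten_operator ::
    "(real^'n::finite \<Rightarrow> real^'n) \<Rightarrow> (real^'n \<Rightarrow> real^'n) \<Rightarrow> 'n \<Rightarrow> real^'n \<Rightarrow>
     (real^'n \<Rightarrow> real^'n) \<Rightarrow> bool" where
  "weingarten_operator r \<nu> m R W \<longleftrightarrow>
     linear W \<and> W (\<nu> R) = 0 \<and>
     W ` hypersurface_tangent r m R \<subseteq> hypersurface_tangent r m R \<and>
     (\<forall>v. v $ m = 0 \<longrightarrow> frechet_derivative \<nu> (at R) v = W (frechet_derivative r (at R) v))"

text \<open>At \<open>R\<close>, the coordinates other than the \<open>m\<close>-th are curvature line coordinates, with principal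
  curvatures \<open>k i\<close>: the coordinate directions are mutually orthogonal principal directions.\<close>

definition curvature_line_coordinates_at ::
    "(real^'n::finite \<Rightarrow> real^'n) \<Rightarrow> 'n \<Rightarrow> real^'n \<Rightarrow> (real^'n \<Rightarrow> real^'n) \<Rightarrow> ('n \<Rightarrow> real) \<Rightarrow> bool" where
  "curvature_line_coordinates_at r m R W k \<longleftrightarrow>
     (\<forall>i. i \<noteq> m \<longrightarrow> pd i r R \<noteq> 0 \<and> W (pd i r R) = k i *\<^sub>R pd i r R) \<and>
     (\<forall>i j. i \<noteq> m \<longrightarrow> j \<noteq> m \<longrightarrow> i \<noteq> j \<longrightarrow> pd i r R \<bullet> pd j r R = 0)"

text \<open>An operator \<open>W\<close> at \<open>r R\<close>, expressed in the coordinates. This is what allows one to compare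
  Weingarten operators of different hypersurfaces parametrised by the same coordinates.\<close>

definition in_coordinates ::
    "(real^'n::finite \<Rightarrow> real^'n) \<Rightarrow> real^'n \<Rightarrow> (real^'n \<Rightarrow> real^'n) \<Rightarrow> real^'n \<Rightarrow> real^'n" where
  "in_coordinates r R W = inv (frechet_derivative r (at R)) \<circ> W \<circ> frechet_derivative r (at R)"

definition admissible_on :: "(real^'n::finite) set \<Rightarrow> ('n \<Rightarrow> real \<Rightarrow> real) \<Rightarrow> real \<Rightarrow> bool" where
  "admissible_on V \<eta> l \<longleftrightarrow> (\<forall>R\<in>V. \<forall>i. l + \<eta> i (R $ i) > 0)"

end

theory Submission
  imports Defs
begin

text \<open>
  Put \<open>s\<^sub>i = sqrt (\<lambda> + \<eta>\<^sub>i)\<close>, \<open>b\<^sub>i\<^sub>j = s\<^sub>i \<beta>\<^sub>i\<^sub>j / s\<^sub>j\<close> and \<open>h\<^sub>i = H\<^sub>i / s\<^sub>i\<close>. The equations to be solved are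
  those of the frame of an orthogonal coordinate system with coefficients \<open>h\<^sub>i\<close> and rotation
  coefficients \<open>b\<^sub>i\<^sub>j\<close>. Their compatibility conditions are the Lame equations
  \<open>\<partial>\<^sub>k b\<^sub>i\<^sub>j = b\<^sub>i\<^sub>k b\<^sub>k\<^sub>j\<close> and \<open>\<partial>\<^sub>i b\<^sub>i\<^sub>j + \<partial>\<^sub>j b\<^sub>j\<^sub>i + \<Sum>\<^sub>k b\<^sub>k\<^sub>i b\<^sub>k\<^sub>j = 0\<close> (\<open>lame_flatness\<close>). The given
  equations for \<open>\<beta>\<close> are designed so that the \<open>b\<^sub>i\<^sub>j\<close> satisfy both for every \<open>\<lambda>\<close>: after
  multiplication by \<open>s\<^sub>i s\<^sub>j\<close> the second one is affine in \<open>\<lambda>\<close>, and the equations for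
  \<open>\<partial>\<^sub>i \<beta>\<^sub>i\<^sub>j\<close> say that both its coefficients vanish (\<open>lame_of_pencil\<close>, \<open>pencil_frame\<close>).

  It remains to integrate a flat linear system with smooth coefficients
  (\<open>flat_linear_system_solution\<close>). The solution is defined by solving an ordinary differential
  equation along each ray from a base point; a Gronwall estimate for two neighbouring rays, in which
  flatness cancels the terms of first order, shows that it is differentiable and solves the system.
  This works on every convex open set. That is essential: the same neighbourhood has to
  serve all admissible \<open>\<lambda>\<close>, although the coefficients may be unbounded near its boundary.
  Skewness of the coefficients keeps the frame orthonormal (\<open>lame_system_solution\<close>).

  The geometry is then read off in the frame (\<open>orthogonal_frame_geometry\<close>): the differential of
  \<open>r\<close> is invertible, and \<open>\<partial>\<^sub>i \<phi>\<^sub>m\<close> is the multiple \<open>\<kappa>\<^sub>m\<^sub>i = s\<^sub>m \<beta>\<^sub>m\<^sub>i / H\<^sub>i\<close> of \<open>\<partial>\<^sub>i r\<close>. In the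
  coordinates the Weingarten operator of \<open>R\<^sub>m = c\<close> is the diagonal matrix of these \<open>\<kappa>\<^sub>m\<^sub>i\<close>, which
  depend on \<open>\<lambda>\<close> only through the factor \<open>s\<^sub>m\<close>, constant on the hypersurface.
\<close>

section \<open>Functions of class \<open>C\<^sup>k\<close>\<close>

lemma frechet_derivative_cong_on:
  assumes "open S" "x \<in> S" "\<And>y. y \<in> S \<Longrightarrow> f y = g y"
  shows "frechet_derivative f (at x) = frechet_derivative g (at x)"
    and "f differentiable (at x) \<longleftrightarrow> g differentiable (at x)"
proof -
  have "(f has_derivative D) (at x) \<longleftrightarrow> (g has_derivative D) (at x)" for D
    using has_derivative_transform_within_open[OF _ assms(1,2), of f D UNIV g]
      has_derivative_transform_within_open[OF _ assms(1,2), of g D UNIV f] assms(3)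
    by auto
  then show "frechet_derivative f (at x) = frechet_derivative g (at x)"
    and "f differentiable (at x) \<longleftrightarrow> g differentiable (at x)"
    by (simp_all add: frechet_derivative_def differentiable_def)
qed

text \<open>Allows derivatives to be replaced by formulas that hold on \<open>S\<close> only.\<close>
lemma Ck_on_cong:
  assumes "open S" "\<And>y. y \<in> S \<Longrightarrow> f y = g y"
  shows "Ck_on k S f \<longleftrightarrow> Ck_on k S g"
  using assms(2)
proof (induction k arbitrary: f g)
  case 0
  then show ?case by (simp cong: continuous_on_cong)
next
  case (Suc k)
  have d: "f differentiable (at x) \<longleftrightarrow> g differentiable (at x)"
    "frechet_derivative f (at x) = frechet_derivative g (at x)" if "x \<in> S" for x
    using frechet_derivative_cong_on[OF assms(1) that, of f g] Suc.prems by auto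
  then have "Ck_on k S (\<lambda>x. frechet_derivative f (at x) v)
      \<longleftrightarrow> Ck_on k S (\<lambda>x. frechet_derivative g (at x) v)" for v
    by (intro Suc.IH) auto
  with d show ?case by auto
qed

text \<open>The working form of the recursion: any explicit formula for the derivative will do, so that the
  closure properties below follow by induction on \<open>k\<close> from the rules of
  differentiation.\<close>
lemma Ck_on_Suc:
  assumes "open S" "\<And>x. x \<in> S \<Longrightarrow> (f has_derivative D x) (at x)" "\<And>v. Ck_on k S (\<lambda>x. D x v)"
  shows "Ck_on (Suc k) S f"
proof -
  have "frechet_derivative f (at x) = D x" if "x \<in> S" for x
    using assms(2)[OF that] by (metis frechet_derivative_at)
  then have "Ck_on k S (\<lambda>x. frechet_derivative f (at x) v)" for v
    using Ck_on_cong[OF assms(1), of "\<lambda>x. frechet_derivative f (at x) v" "\<lambda>x. D x v"] assms(3)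
    by auto
  with assms(2) show ?thesis by (auto simp: differentiable_def)
qed

lemma Ck_on_has_derivative:
  assumes "Ck_on (Suc k) S f" "x \<in> S"
  shows "(f has_derivative frechet_derivative f (at x)) (at x)"
  using assms by (simp add: frechet_derivative_works)

lemma Ck_on_SucD: "Ck_on (Suc k) S f \<Longrightarrow> Ck_on k S f"
proof (induction k arbitrary: f)
  case 0
  then show ?case
    by (simp add: differentiable_imp_continuous_on differentiable_at_withinI
        differentiable_on_def)
next
  case (Suc k)
  then show ?case by (metis Ck_on.simps(2))
qed

lemma Ck_on_subset: "Ck_on k S f \<Longrightarrow> T \<subseteq> S \<Longrightarrow> Ck_on k T f"
  by (induction k arbitrary: f) (auto intro: continuous_on_subset)

lemma Ck_on_const: "open S \<Longrightarrow> Ck_on k S (\<lambda>x. c)"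
proof (induction k arbitrary: c)
  case (Suc k)
  then show ?case by (intro Ck_on_Suc[where D = "\<lambda>x v. 0"]) auto
qed auto

lemma Ck_on_add:
  assumes "open S"
  shows "Ck_on k S f \<Longrightarrow> Ck_on k S g \<Longrightarrow> Ck_on k S (\<lambda>x. f x + g x)"
proof (induction k arbitrary: f g)
  case (Suc k)
  show ?case
    by (rule Ck_on_Suc[OF assms(1) has_derivative_add[OF Ck_on_has_derivative Ck_on_has_derivative]])
      (use Suc in auto)
qed (auto intro: continuous_intros)

lemma Ck_on_sum:
  assumes "open S" "\<And>i. i \<in> I \<Longrightarrow> Ck_on k S (f i)"
  shows "Ck_on k S (\<lambda>x. \<Sum>i\<in>I. f i x)"
  using assms(2)
  by (induction I rule: infinite_finite_induct) (auto intro: Ck_on_const Ck_on_add assms(1))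

lemma Ck_on_linear:
  assumes "open S" "bounded_linear L"
  shows "Ck_on k S f \<Longrightarrow> Ck_on k S (\<lambda>x. L (f x))"
proof (induction k arbitrary: f)
  case 0
  then show ?case using assms by (auto intro: bounded_linear.continuous_on)
next
  case (Suc k)
  show ?case
    by (rule Ck_on_Suc[OF assms(1) bounded_linear.has_derivative[OF assms(2) Ck_on_has_derivative]])
      (use Suc in auto)
qed

lemma Ck_on_compose_linear:
  assumes "open S" "bounded_linear L" "L ` S \<subseteq> T"
  shows "Ck_on k T f \<Longrightarrow> Ck_on k S (\<lambda>x. f (L x))"
proof (induction k arbitrary: f)
  case 0
  then show ?case
    using continuous_on_compose2[OF _ linear_continuous_on[OF assms(2)] assms(3)] by simp
next
  case (Suc k)
  have "((\<lambda>x. f (L x)) has_derivative (\<lambda>v. frechet_derivative f (at (L x)) (L v))) (at x)"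
    if "x \<in> S" for x
    using has_derivative_compose[OF bounded_linear_imp_has_derivative[OF assms(2)]
        Ck_on_has_derivative[OF Suc.prems]] that assms(3) by auto
  then show ?case
    by (rule Ck_on_Suc[OF assms(1)]) (use Suc in auto)
qed

lemma Ck_on_scaleR:
  fixes f :: "'a::real_normed_vector \<Rightarrow> real"
  assumes "open S"
  shows "Ck_on k S f \<Longrightarrow> Ck_on k S g \<Longrightarrow> Ck_on k S (\<lambda>x. f x *\<^sub>R g x)"
proof (induction k arbitrary: f g)
  case (Suc k)
  have k: "Ck_on k S f" "Ck_on k S g"
    using Suc.prems by (auto intro: Ck_on_SucD simp del: Ck_on.simps)
  show ?case
    by (rule Ck_on_Suc[OF assms(1) has_derivative_scaleR[OF Ck_on_has_derivative Ck_on_has_derivative]])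
      (use Suc.prems k in \<open>auto intro!: Ck_on_add assms Suc.IH\<close>)
qed (auto intro: continuous_intros)

lemma Ck_on_mult:
  fixes f g :: "'a::real_normed_vector \<Rightarrow> real"
  assumes "open S" "Ck_on k S f" "Ck_on k S g" 
  shows "Ck_on k S (\<lambda>x. f x * g x)"
  using Ck_on_scaleR[OF assms] by simp

lemma Ck_on_inverse:
  fixes f :: "'a::real_normed_vector \<Rightarrow> real"
  assumes "open S" "\<And>x. x \<in> S \<Longrightarrow> f x \<noteq> 0"
  shows "Ck_on k S f \<Longrightarrow> Ck_on k S (\<lambda>x. inverse (f x))"
proof (induction k)
  case 0
  then show ?case using assms by (auto intro!: continuous_intros)
next
  case (Suc k)
  have D: "((\<lambda>x. inverse (f x)) has_derivative
      (\<lambda>v. (- 1) * (inverse (f x) * frechet_derivative f (at x) v * inverse (f x)))) (at x)"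
    if "x \<in> S" for x
    using Deriv.has_derivative_inverse[OF assms(2)[OF that] Ck_on_has_derivative[OF Suc.prems that]]
    by simp
  have k: "Ck_on k S (\<lambda>x. inverse (f x))"
    using Suc.IH Ck_on_SucD[OF Suc.prems] by blast
  show ?case
  proof (rule Ck_on_Suc[OF assms(1) D])
    show "Ck_on k S (\<lambda>x. (- 1) * (inverse (f x) * frechet_derivative f (at x) v * inverse (f x)))" for v
      using Suc.prems k by (intro Ck_on_mult Ck_on_const assms(1)) auto
  qed
qed

lemma Ck_on_sqrt:
  fixes f :: "'a::real_normed_vector \<Rightarrow> real"
  assumes "open S" "\<And>x. x \<in> S \<Longrightarrow> f x > 0"
  shows "Ck_on k S f \<Longrightarrow> Ck_on k S (\<lambda>x. sqrt (f x))"
proof (induction k)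
  case 0
  then show ?case using assms by (auto intro!: continuous_intros)
next
  case (Suc k)
  have D: "((\<lambda>x. sqrt (f x)) has_derivative
      (\<lambda>v. frechet_derivative f (at x) v * (inverse (sqrt (f x)) * (1/2)))) (at x)"
    if "x \<in> S" for x
    using has_derivative_real_sqrt[OF assms(2)[OF that] Ck_on_has_derivative[OF Suc.prems that]]
    by (simp add: field_simps)
  have k: "Ck_on k S (\<lambda>x. sqrt (f x))"
    using Suc.IH Ck_on_SucD[OF Suc.prems] by blast
  show ?case
  proof (rule Ck_on_Suc[OF assms(1) D])
    have "Ck_on k S (\<lambda>x. inverse (sqrt (f x)))"
      using assms(2) by (intro Ck_on_inverse k assms(1)) fastforce
    then show "Ck_on k S (\<lambda>x. frechet_derivative f (at x) v * (inverse (sqrt (f x)) * (1/2)))" for v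
      using Suc.prems by (intro Ck_on_mult Ck_on_const assms(1)) auto
  qed
qed

lemma pd_eqI: "(f has_derivative D) (at R) \<Longrightarrow> pd i f R = D (axis i 1)"
  unfolding pd_def by (metis frechet_derivative_at)

lemma pd_mult:
  assumes "(f has_derivative f') (at R)" "(g has_derivative g') (at R)"
  shows "pd i (\<lambda>R. f R * g R :: real) R = pd i f R * g R + f R * pd i g R"
  using pd_eqI[OF has_derivative_mult[OF assms]] pd_eqI[OF assms(1)] pd_eqI[OF assms(2)] by simp

lemma frechet_derivative_eq_sum_pd:
  fixes f :: "real^'n::finite \<Rightarrow> 'b::real_normed_vector"
  assumes "f differentiable (at R)"
  shows "frechet_derivative f (at R) v = (\<Sum>i\<in>UNIV. (v $ i) *\<^sub>R pd i f R)"
proof -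
  have l: "linear (frechet_derivative f (at R))"
    using assms linear_frechet_derivative by blast
  have "v = (\<Sum>i\<in>UNIV. (v $ i) *\<^sub>R axis i 1)"
    by (simp add: vec_eq_iff axis_def if_distrib cong: if_cong)
  then have "frechet_derivative f (at R) v = frechet_derivative f (at R) (\<Sum>i\<in>UNIV. (v $ i) *\<^sub>R axis i 1)"
    by metis
  also have "\<dots> = (\<Sum>i\<in>UNIV. (v $ i) *\<^sub>R pd i f R)"
    by (simp add: linear_sum[OF l] linear_scale[OF l] pd_def)
  finally show ?thesis .
qed

section \<open>Linear differential equations on the unit interval\<close>

lemma linear_eq_sum_Basis:
  fixes f :: "'e::euclidean_space \<Rightarrow> 'b::real_vector"
  assumes "linear f"
  shows "f x = (\<Sum>b\<in>Basis. (x \<bullet> b) *\<^sub>R f b)"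
proof -
  have "f x = f (\<Sum>b\<in>Basis. (x \<bullet> b) *\<^sub>R b)" by (simp add: euclidean_representation)
  also have "\<dots> = (\<Sum>b\<in>Basis. (x \<bullet> b) *\<^sub>R f b)"
    by (simp add: linear_sum[OF assms] linear_scale[OF assms])
  finally show ?thesis .
qed

lemma continuous_on_linear_family:
  fixes B :: "'a::topological_space \<Rightarrow> 'e::euclidean_space \<Rightarrow> 'b::real_normed_vector"
  assumes "\<And>t. t \<in> S \<Longrightarrow> linear (B t)" "\<And>x. continuous_on S (\<lambda>t. B t x)" "continuous_on S y"
  shows "continuous_on S (\<lambda>t. B t (y t))"
proof -
  have "continuous_on S (\<lambda>t. \<Sum>b\<in>Basis. (y t \<bullet> b) *\<^sub>R B t b)"
    by (intro continuous_intros assms)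
  then show ?thesis
    using linear_eq_sum_Basis[OF assms(1)] by (simp cong: continuous_on_cong)
qed

lemma bounded_linear_family:
  fixes B :: "'a::topological_space \<Rightarrow> 'e::euclidean_space \<Rightarrow> 'b::real_normed_vector"
  assumes "compact S" "\<And>t. t \<in> S \<Longrightarrow> linear (B t)" "\<And>x. continuous_on S (\<lambda>t. B t x)"
  shows "\<exists>C>0. \<forall>t\<in>S. \<forall>x. norm (B t x) \<le> C * norm x"
proof -
  have "\<exists>c. \<forall>t\<in>S. norm (B t b) \<le> c" for b
    using compact_imp_bounded[OF compact_continuous_image[OF assms(3)[of b] assms(1)]]
    by (auto simp: bounded_iff)
  then obtain c where c: "\<And>b t. t \<in> S \<Longrightarrow> norm (B t b) \<le> c b" by metis
  define C where "C = (\<Sum>b\<in>Basis. \<bar>c b\<bar>) + 1"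
  show ?thesis
  proof (intro exI conjI ballI allI)
    show "C > 0" unfolding C_def by (smt (verit) sum_nonneg abs_ge_zero)
  next
    fix t x assume t: "t \<in> S"
    have "norm (B t x) = norm (\<Sum>b\<in>Basis. (x \<bullet> b) *\<^sub>R B t b)"
      using linear_eq_sum_Basis[OF assms(2)[OF t]] by metis
    also have "\<dots> \<le> (\<Sum>b\<in>Basis. norm x * \<bar>c b\<bar>)"
    proof (rule sum_norm_le)
      fix b :: 'e assume b: "b \<in> Basis"
      have "norm (B t b) \<le> \<bar>c b\<bar>" using c[OF t, of b] by linarith
      then show "norm ((x \<bullet> b) *\<^sub>R B t b) \<le> norm x * \<bar>c b\<bar>"
        using Basis_le_norm[OF b, of x] by (auto intro!: mult_mono)
    qed
    also have "\<dots> \<le> C * norm x" by (simp add: C_def sum_distrib_left[symmetric] algebra_simps)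
    finally show "norm (B t x) \<le> C * norm x" .
  qed
qed

text \<open>With \<open>K = 2 C + 1\<close>, the hypothesis on \<open>F'\<close> and \<open>2 e |F| \<le>
  |F|\<^sup>2 + e\<^sup>2\<close> give \<open>(|F|\<^sup>2)' \<le> K |F|\<^sup>2 +
  e\<^sup>2\<close>, so that \<open>exp (- K t) |F|\<^sup>2 - e\<^sup>2 t\<close> does not increase.
  Working with the square avoids differentiating the norm.\<close>
lemma linear_ode_gronwall:
  fixes F :: "real \<Rightarrow> 'e::real_inner"
  assumes F: "\<And>t. t \<in> {0..1} \<Longrightarrow> (F has_vector_derivative F' t) (at t within {0..1})"
    and C: "C \<ge> 0" "\<And>t. t \<in> {0..1} \<Longrightarrow> norm (F' t) \<le> C * norm (F t) + e"
    and "F 0 = 0" "s \<in> {0..1}"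
  shows "norm (F s) \<le> e * exp (C + 1)"
proof -
  have e: "e \<ge> 0" using C(2)[of 0] assms(4) norm_ge_zero[of "F' 0"] by (simp del: norm_ge_zero)
  define K where "K = 2 * C + 1"
  define u where "u t = exp (- K * t) * (F t \<bullet> F t) - e\<^sup>2 * t" for t
  have "u 0 \<ge> u s"
  proof (rule DERIV_nonpos_imp_decreasing_open[where f = u and a = 0 and b = s])
    have "continuous_on {0..1} F"
      using F by (rule continuous_on_vector_derivative)
    then have "continuous_on {0..s} F"
      by (rule continuous_on_subset) (use assms(5) in auto)
    then show "continuous_on {0..s} u"
      unfolding u_def by (intro continuous_intros)
  next
    fix t assume t: "0 < t" "t < s"
    then have t1: "t \<in> {0..1}" "0 < t" "t < 1" using assms(5) by auto
    have Ft: "(F has_vector_derivative F' t) (at t)"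
      using F[OF t1(1)] t1 by (metis at_within_Icc_at)
    have "((\<lambda>t. F t \<bullet> F t) has_derivative (\<lambda>h. F t \<bullet> (h *\<^sub>R F' t) + (h *\<^sub>R F' t) \<bullet> F t)) (at t)"
      using Ft by (intro has_derivative_inner) (auto simp: has_vector_derivative_def)
    then have "((\<lambda>t. F t \<bullet> F t) has_real_derivative (2 * (F t \<bullet> F' t))) (at t)"
      unfolding has_field_derivative_def by (rule has_derivative_eq_rhs) (auto simp: inner_commute)
    then have D: "(u has_real_derivative
        (- K * exp (- K * t) * (F t \<bullet> F t) + exp (- K * t) * (2 * (F t \<bullet> F' t)) - e\<^sup>2)) (at t)"
      unfolding u_def by (auto intro!: derivative_eq_intros)
    have "F t \<bullet> F' t \<le> norm (F t) * (C * norm (F t) + e)"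
      using norm_cauchy_schwarz[of "F t" "F' t"] mult_left_mono[OF C(2)[OF t1(1)], of "norm (F t)"]
      by auto
    then have "2 * (F t \<bullet> F' t) \<le> K * (norm (F t))\<^sup>2 + e\<^sup>2"
      using zero_le_power2[of "norm (F t) - e"]
      by (simp add: K_def power2_eq_square algebra_simps)
    then have "exp (- K * t) * (2 * (F t \<bullet> F' t) - K * (F t \<bullet> F t)) \<le> exp (- K * t) * e\<^sup>2"
      by (intro mult_left_mono) (auto simp: power2_norm_eq_inner)
    also have "\<dots> \<le> 1 * e\<^sup>2"
    proof (rule mult_right_mono)
      have "0 \<le> K * t" using C(1) t1 by (auto simp: K_def)
      then show "exp (- K * t) \<le> 1" by simp
    qed simp
    finally show "\<exists>y. (u has_real_derivative y) (at t) \<and> y \<le> 0"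
      using D by (intro exI[of _ "- K * exp (- K * t) * (F t \<bullet> F t) + exp (- K * t) * (2 * (F t \<bullet> F' t)) - e\<^sup>2"])
        (auto simp: algebra_simps)
  qed (use assms(5) in auto)
  then have "exp (- K * s) * (norm (F s))\<^sup>2 \<le> e\<^sup>2 * s"
    using assms(4) by (simp add: u_def power2_norm_eq_inner)
  also have "\<dots> \<le> e\<^sup>2 * 1" using assms(5) by (intro mult_left_mono) auto
  finally have "exp (K * s) * (exp (- K * s) * (norm (F s))\<^sup>2) \<le> exp (K * s) * e\<^sup>2"
    by (intro mult_left_mono) auto
  then have "(norm (F s))\<^sup>2 \<le> exp (K * s) * e\<^sup>2"
    by (simp add: mult.assoc[symmetric] exp_add[symmetric])
  also have "\<dots> \<le> (exp (C + 1))\<^sup>2 * e\<^sup>2"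
  proof (rule mult_right_mono)
    have "K * s \<le> K * 1" using assms(5) C(1) by (intro mult_left_mono) (auto simp: K_def)
    then show "exp (K * s) \<le> (exp (C + 1))\<^sup>2"
      by (simp add: K_def exp_double[symmetric] )
  qed auto
  finally have "(norm (F s))\<^sup>2 \<le> (e * exp (C + 1))\<^sup>2" by (simp add: power_mult_distrib mult.commute)
  then show ?thesis using e by (simp add: power2_le_iff_abs_le)
qed

text \<open>Picard iteration: the increments satisfy \<open>X\<^sub>k\<^sub>+\<^sub>1' = B X\<^sub>k\<close>
  and are at most \<open>|x\<^sub>0| (C t)\<^sup>k / k!\<close>, so the series of the increments and
  that of their derivatives converge uniformly on the whole interval. Linearity is what makes the
  solution global.\<close>
lemma linear_ode_exists:
  fixes B :: "real \<Rightarrow> 'e::euclidean_space \<Rightarrow> 'e"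
  assumes lin: "\<And>t. t \<in> {0..1} \<Longrightarrow> linear (B t)" and cont: "\<And>x. continuous_on {0..1} (\<lambda>t. B t x)"
  obtains y where "y 0 = x0"
    "\<And>t. t \<in> {0..1} \<Longrightarrow> (y has_vector_derivative B t (y t)) (at t within {0..1})"
proof -
  obtain C where C: "C > 0" "\<And>t x. t \<in> {0..1} \<Longrightarrow> norm (B t x) \<le> C * norm x"
    using bounded_linear_family[of "{0..1}" B, OF compact_Icc lin cont] by blast
  define X where "X = rec_nat (\<lambda>t. x0) (\<lambda>k x t. integral {0..t} (\<lambda>u. B u (x u)))"
  have X0: "X 0 t = x0" and XS: "X (Suc k) t = integral {0..t} (\<lambda>u. B u (X k u))" for k t
    by (simp_all add: X_def)
  define f where "f k t = B t (X k t)" for k t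
  have Xc: "continuous_on {0..1} (X k)" for k
  proof (induction k)
    case 0
    then show ?case by (simp add: X_def)
  next
    case (Suc k)
    have "continuous_on {0..1} (\<lambda>u. B u (X k u))"
      by (rule continuous_on_linear_family[OF lin cont Suc])
    then have "continuous_on {0..1} (\<lambda>t. integral {0..t} (\<lambda>u. B u (X k u)))"
      by (intro indefinite_integral_continuous_1 integrable_continuous_real)
    then show ?case unfolding XS .
  qed
  have fc: "continuous_on {0..1} (\<lambda>u. B u (X k u))" for k
    by (rule continuous_on_linear_family[OF lin cont Xc])
  have bound: "norm (X k t) \<le> norm x0 * (C * t) ^ k / fact k" if "t \<in> {0..1}" for k t
    using that
  proof (induction k arbitrary: t)
    case 0
    then show ?case by (simp add: X0)
  next
    case (Suc k)
    have hi: "((\<lambda>u. C * (norm x0 * (C * u) ^ k / fact k)) has_integral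
        (norm x0 * (C * t) ^ Suc k / fact (Suc k) - norm x0 * (C * 0) ^ Suc k / fact (Suc k))) {0..t}"
    proof (rule fundamental_theorem_of_calculus)
      fix u assume "u \<in> {0..t}"
      define c where "c = norm x0 * C ^ Suc k / fact (Suc k)"
      have "((\<lambda>u. c * u ^ Suc k) has_real_derivative c * (real (Suc k) * u ^ k)) (at u within {0..t})"
        by (rule DERIV_cmult) (use DERIV_pow[of "Suc k" u "{0..t}"] in simp)
      moreover have "(\<lambda>u. c * u ^ Suc k) = (\<lambda>u. norm x0 * (C * u) ^ Suc k / fact (Suc k))"
        by (simp add: c_def power_mult_distrib mult.assoc del: fact_Suc power_Suc)
      moreover have "c * (real (Suc k) * u ^ k) = C * (norm x0 * (C * u) ^ k / fact k)"
        by (simp add: c_def power_mult_distrib divide_simps del: of_nat_Suc)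
      ultimately show "((\<lambda>u. norm x0 * (C * u) ^ Suc k / fact (Suc k)) has_vector_derivative
          C * (norm x0 * (C * u) ^ k / fact k)) (at u within {0..t})"
        by (simp only: has_real_derivative_iff_has_vector_derivative)
    qed (use Suc in auto)
    have "norm (X (Suc k) t) \<le> integral {0..t} (\<lambda>u. C * (norm x0 * (C * u) ^ k / fact k))"
      unfolding XS
    proof (rule integral_norm_bound_integral)
      show "(\<lambda>u. B u (X k u)) integrable_on {0..t}"
        using Suc.prems by (intro integrable_continuous_real continuous_on_subset[OF fc]) auto
      show "(\<lambda>u. C * (norm x0 * (C * u) ^ k / fact k)) integrable_on {0..t}"
        using hi by blast
      fix u assume "u \<in> {0..t}"
      then have u: "u \<in> {0..1}" using Suc.prems by auto
      show "norm (B u (X k u)) \<le> C * (norm x0 * (C * u) ^ k / fact k)"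
        using C(2)[OF u, of "X k u"] mult_left_mono[OF Suc.IH[OF u], of C] C(1) by linarith
    qed
    also have "\<dots> = norm x0 * (C * t) ^ Suc k / fact (Suc k) - norm x0 * (C * 0) ^ Suc k / fact (Suc k)"
      using hi by (rule integral_unique)
    also have "\<dots> = norm x0 * (C * t) ^ Suc k / fact (Suc k)" by simp
    finally show ?case .
  qed
  define M where "M k = norm x0 * (C ^ k / fact k)" for k
  have M: "summable M"
    unfolding M_def by (intro summable_mult) (use summable_exp[of C] in \<open>simp add: field_simps\<close>)
  have XM: "norm (X k t) \<le> M k" if "t \<in> {0..1}" for k t
  proof -
    have "(C * t) ^ k \<le> C ^ k"
      using that C(1) by (intro power_mono) (auto simp: mult_left_le)
    then have "norm x0 * ((C * t) ^ k / fact k) \<le> M k"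
      unfolding M_def by (intro mult_left_mono divide_right_mono) auto
    then show ?thesis using bound[OF that, of k] by simp
  qed
  define y where "y t = (\<Sum>k. X k t)" for t
  have ul: "uniform_limit {0..1} (\<lambda>n t. \<Sum>k<n. X k t) y sequentially"
    unfolding y_def using XM M by (rule Weierstrass_m_test)
  \<comment> \<open>The derivatives of the increments; the zeroth increment is constant.\<close>
  define X' where "X' k t = (case k of 0 \<Rightarrow> 0 | Suc j \<Rightarrow> B t (X j t))" for k t
  have X'sum: "(\<Sum>k<Suc n. X' k t) = B t (\<Sum>k<n. X k t)" if "t \<in> {0..1}" for n t
    unfolding sum.lessThan_Suc_shift by (simp add: X'_def linear_sum[OF lin[OF that]])
  have "\<exists>g. \<forall>t\<in>{0..1}. (\<lambda>n. X n t) sums g t \<and> (g has_derivative (\<lambda>h. h *\<^sub>R B t (y t))) (at t within {0..1})"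
  proof (rule has_derivative_series[where f' = "\<lambda>k t h. h *\<^sub>R X' k t"])
    fix k t assume t: "t \<in> {0..1::real}"
    show "(X k has_derivative (\<lambda>h. h *\<^sub>R X' k t)) (at t within {0..1})"
    proof (cases k)
      case 0
      then show ?thesis by (simp add: X_def X'_def)
    next
      case (Suc j)
      have "(\<lambda>t. X (Suc j) t) = (\<lambda>t. integral {0..t} (\<lambda>u. B u (X j u)))" by (simp add: XS)
      then show ?thesis
        using integral_has_vector_derivative[OF fc t, of j]
        by (simp add: Suc X'_def has_vector_derivative_def)
    qed
  next
    fix e :: real assume e: "e > 0"
    have "\<forall>\<^sub>F n in sequentially. \<forall>t\<in>{0..1}. dist (\<Sum>k<n. X k t) (y t) < e / C"
      using uniform_limitD[OF ul] e C(1) by simp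
    then have "\<forall>\<^sub>F n in sequentially. \<forall>t\<in>{0..1}. \<forall>h.
        norm ((\<Sum>i<Suc n. h *\<^sub>R X' i t) - h *\<^sub>R B t (y t)) \<le> e * norm h"
    proof eventually_elim
      case (elim n)
      show ?case
      proof (intro ballI allI)
        fix t h :: real assume t: "t \<in> {0..1}"
        have "norm ((\<Sum>k<n. X k t) - y t) \<le> e / C"
          using bspec[OF elim t] unfolding dist_norm by (rule less_imp_le)
        then have "C * norm ((\<Sum>k<n. X k t) - y t) \<le> C * (e / C)"
          using less_imp_le[OF C(1)] by (rule mult_left_mono)
        with C(2)[OF t] have "norm (B t ((\<Sum>k<n. X k t) - y t)) \<le> C * (e / C)"
          by (rule order_trans)
        then have "norm (B t (\<Sum>k<n. X k t) - B t (y t)) \<le> e"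
          using C(1) by (simp add: linear_diff[OF lin[OF t]])
        moreover have "(\<Sum>i<Suc n. h *\<^sub>R X' i t) - h *\<^sub>R B t (y t)
            = h *\<^sub>R (B t (\<Sum>k<n. X k t) - B t (y t))"
          unfolding X'sum[OF t, symmetric] scaleR_sum_right[symmetric] by (simp add: algebra_simps)
        ultimately show "norm ((\<Sum>i<Suc n. h *\<^sub>R X' i t) - h *\<^sub>R B t (y t)) \<le> e * norm h"
          by (simp only: norm_scaleR mult.commute[of e]) (auto intro!: mult_left_mono)
      qed
    qed
    then show "\<forall>\<^sub>F n in sequentially. \<forall>t\<in>{0..1}. \<forall>h.
        norm ((\<Sum>i<n. h *\<^sub>R X' i t) - h *\<^sub>R B t (y t)) \<le> e * norm h"
      by (rule eventually_sequentially_Suc[THEN iffD1])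
  next
    show "(\<lambda>n. X n 0) sums suminf (\<lambda>n. X n 0)"
      by (rule summable_sums, rule summable_comparison_test'[OF M, of 0]) (use XM in auto)
  qed auto
  then obtain g where g: "\<And>t. t \<in> {0..1} \<Longrightarrow> (\<lambda>n. X n t) sums g t"
    "\<And>t. t \<in> {0..1} \<Longrightarrow> (g has_derivative (\<lambda>h. h *\<^sub>R B t (y t))) (at t within {0..1})" by blast
  have gy: "g t = y t" if "t \<in> {0..1}" for t
    using g(1)[OF that] by (simp add: y_def sums_iff)
  have "(\<lambda>n. X n 0) sums x0"
  proof -
    have "X n 0 = (if n = 0 then x0 else 0)" for n
      by (cases n) (simp_all add: X0 XS)
    then show ?thesis using sums_single[of 0 "\<lambda>_. x0"] by (simp cong: if_cong)
  qed
  then have "g 0 = x0" using g(1)[of 0] sums_unique2 by fastforce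
  show ?thesis
    by (rule that[of g, OF \<open>g 0 = x0\<close>]) (use g(2) gy in \<open>simp add: has_vector_derivative_def\<close>)
qed

section \<open>Uniform estimates on compact convex sets\<close>

lemma norm_directional_le:
  fixes D :: "real^'n::finite \<Rightarrow> 'b::real_normed_vector"
  assumes "linear D" "\<And>i. norm (D (axis i 1)) \<le> c i"
  shows "norm (D v) \<le> (\<Sum>i\<in>UNIV. c i) * norm v"
proof -
  have "D v = D (\<Sum>i\<in>UNIV. (v $ i) *\<^sub>R axis i 1)"
    by (rule arg_cong[where f = D]) (simp add: vec_eq_iff axis_def if_distrib cong: if_cong)
  also have "\<dots> = (\<Sum>i\<in>UNIV. (v $ i) *\<^sub>R D (axis i 1))"
    by (simp add: linear_sum[OF assms(1)] linear_scale[OF assms(1)])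
  also have "norm \<dots> \<le> (\<Sum>i\<in>UNIV. norm v * c i)"
  proof (rule sum_norm_le)
    fix i
    show "norm ((v $ i) *\<^sub>R D (axis i 1)) \<le> norm v * c i"
      using assms(2)[of i] component_le_norm_cart[of v i] by (auto intro!: mult_mono)
  qed
  also have "\<dots> = (\<Sum>i\<in>UNIV. c i) * norm v"
    by (simp add: sum_distrib_left[symmetric] mult.commute)
  finally show ?thesis .
qed

lemma C1_lipschitz_on_compact:
  fixes f :: "real^'n::finite \<Rightarrow> 'b::real_normed_vector"
  assumes "Ck_on (Suc 0) V f" "compact K" "convex K" "K \<subseteq> V"
  obtains L where "L \<ge> 0" "\<forall>S\<in>K. \<forall>S'\<in>K. norm (f S' - f S) \<le> L * norm (S' - S)"
proof -
  have "\<exists>c. \<forall>x\<in>K. norm (frechet_derivative f (at x) (axis i 1)) \<le> c" for i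
  proof -
    have "continuous_on K (\<lambda>x. frechet_derivative f (at x) (axis i 1))"
      using assms(1,4) by (auto intro: continuous_on_subset)
    then have "bounded ((\<lambda>x. frechet_derivative f (at x) (axis i 1)) ` K)"
      using compact_imp_bounded compact_continuous_image assms(2) by blast
    then show ?thesis unfolding bounded_iff by blast
  qed
  then obtain c where c: "\<And>i x. x \<in> K \<Longrightarrow> norm (frechet_derivative f (at x) (axis i 1)) \<le> c i"
    by metis
  define L where "L = (\<Sum>i\<in>UNIV. \<bar>c i\<bar>)"
  have D: "(f has_derivative frechet_derivative f (at x)) (at x)" if "x \<in> K" for x
    using Ck_on_has_derivative[OF assms(1)] that assms(4) by blast
  have o: "onorm (frechet_derivative f (at x)) \<le> L" if "x \<in> K" for x
  proof (rule onorm_le)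
    fix v
    have "norm (frechet_derivative f (at x) (axis i 1)) \<le> \<bar>c i\<bar>" for i
      using c[OF that, of i] by linarith
    then show "norm (frechet_derivative f (at x) v) \<le> L * norm v"
      unfolding L_def using has_derivative_linear[OF D[OF that]] by (rule norm_directional_le[rotated])
  qed
  show ?thesis
  proof
    show "L \<ge> 0" unfolding L_def by (simp add: sum_nonneg)
    show "\<forall>S\<in>K. \<forall>S'\<in>K. norm (f S' - f S) \<le> L * norm (S' - S)"
      using differentiable_bound[OF assms(3) has_derivative_at_withinI[OF D] o] by blast
  qed
qed

text \<open>The mean value inequality for \<open>x \<mapsto> f x - Df(S) x\<close> on the segment from
  \<open>S\<close> to \<open>S'\<close>, whose derivative is at most a Lipschitz constant of
  \<open>Df\<close> times the length of the segment. The bound is uniform in \<open>S\<close>, which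
  is needed because it is used simultaneously along a whole ray.\<close>
lemma C2_taylor_on_compact:
  fixes f :: "real^'n::finite \<Rightarrow> 'b::real_normed_vector"
  assumes "Ck_on (Suc (Suc 0)) V f" "compact K" "convex K" "K \<subseteq> V"
  obtains L where "L \<ge> 0" "\<forall>S\<in>K. \<forall>S'\<in>K.
    norm (f S' - f S - frechet_derivative f (at S) (S' - S)) \<le> L * (norm (S' - S))\<^sup>2"
proof -
  have "\<exists>c\<ge>0. \<forall>S\<in>K. \<forall>S'\<in>K. norm (frechet_derivative f (at S') (axis i 1)
      - frechet_derivative f (at S) (axis i 1)) \<le> c * norm (S' - S)" for i
  proof -
    have "Ck_on (Suc 0) V (\<lambda>x. frechet_derivative f (at x) (axis i 1))"
      using assms(1) by simp
    from C1_lipschitz_on_compact[OF this assms(2-4)] show ?thesis by metis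
  qed
  then obtain c where c: "\<And>i. c i \<ge> 0" "\<And>i S S'. S \<in> K \<Longrightarrow> S' \<in> K \<Longrightarrow>
      norm (frechet_derivative f (at S') (axis i 1) - frechet_derivative f (at S) (axis i 1))
      \<le> c i * norm (S' - S)"
    by metis
  define L where "L = (\<Sum>i\<in>UNIV. c i)"
  have D: "(f has_derivative frechet_derivative f (at x)) (at x)" if "x \<in> K" for x
    using Ck_on_has_derivative[OF assms(1)] that assms(4) by blast
  show ?thesis
  proof
    show L0: "L \<ge> 0" unfolding L_def by (simp add: sum_nonneg c)
    show "\<forall>S\<in>K. \<forall>S'\<in>K.
        norm (f S' - f S - frechet_derivative f (at S) (S' - S)) \<le> L * (norm (S' - S))\<^sup>2"
    proof (intro ballI)
      fix S S' assume S: "S \<in> K" "S' \<in> K"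
      let ?D = "\<lambda>x. frechet_derivative f (at x)"
      let ?I = "closed_segment S S'"
      have sub: "?I \<subseteq> K" using S assms(3) by (simp add: closed_segment_subset)
      have "norm ((f S' - ?D S S') - (f S - ?D S S)) \<le> (L * norm (S' - S)) * norm (S' - S)"
      proof (rule differentiable_bound[where S = ?I and f' = "\<lambda>x v. ?D x v - ?D S v"])
        fix x assume x: "x \<in> ?I"
        then have xK: "x \<in> K" using sub by blast
        show "((\<lambda>x. f x - ?D S x) has_derivative (\<lambda>v. ?D x v - ?D S v)) (at x within ?I)"
          by (intro has_derivative_diff has_derivative_at_withinI[OF D[OF xK]]
              bounded_linear_imp_has_derivative has_derivative_bounded_linear[OF D[OF S(1)]])
        show "onorm (\<lambda>v. ?D x v - ?D S v) \<le> L * norm (S' - S)"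
        proof (rule onorm_le)
          fix v
          have "norm (?D x v - ?D S v) \<le> (\<Sum>i\<in>UNIV. c i * norm (x - S)) * norm v"
            using has_derivative_linear[OF D[OF xK]] has_derivative_linear[OF D[OF S(1)]]
            by (intro norm_directional_le linear_compose_sub c(2) S xK)
          also have "\<dots> = L * norm (x - S) * norm v"
            by (simp add: L_def sum_distrib_right)
          also have "\<dots> \<le> L * norm (S' - S) * norm v"
            using L0 segment_bound(1)[OF x] by (intro mult_right_mono mult_left_mono) auto
          finally show "norm (?D x v - ?D S v) \<le> L * norm (S' - S) * norm v" .
        qed
      qed auto
      moreover have "f S' - f S - ?D S (S' - S) = (f S' - ?D S S') - (f S - ?D S S)"
        by (simp add: linear_diff[OF has_derivative_linear[OF D[OF S(1)]]])
      ultimately show "norm (f S' - f S - ?D S (S' - S)) \<le> L * (norm (S' - S))\<^sup>2"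
        by (simp only: power2_eq_square mult.assoc)
    qed
  qed
qed

lemma norm_bilinear_sum_le:
  fixes T :: "'n::finite \<Rightarrow> 'e::euclidean_space \<Rightarrow> 'b::real_normed_vector"
  assumes "\<And>i. linear (T i)" "\<And>i b. b \<in> Basis \<Longrightarrow> norm (T i b) \<le> c i b * N"
  shows "norm (\<Sum>i\<in>UNIV. (v $ i) *\<^sub>R T i x) \<le> (\<Sum>i\<in>UNIV. \<Sum>b\<in>Basis. c i b) * N * norm v * norm x"
proof -
  have "norm (\<Sum>i\<in>UNIV. (v $ i) *\<^sub>R T i x) \<le> (\<Sum>i\<in>UNIV. norm v * (\<Sum>b\<in>Basis. norm x * (c i b * N)))"
  proof (rule sum_norm_le)
    fix i
    have "norm (T i x) \<le> (\<Sum>b\<in>Basis. norm x * (c i b * N))"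
      unfolding linear_eq_sum_Basis[OF assms(1), of i x]
    proof (rule sum_norm_le)
      fix b :: 'e assume b: "b \<in> Basis"
      then show "norm ((x \<bullet> b) *\<^sub>R T i b) \<le> norm x * (c i b * N)"
        using assms(2)[OF b, of i] Basis_le_norm[OF b, of x] by (auto intro!: mult_mono)
    qed
    then show "norm ((v $ i) *\<^sub>R T i x) \<le> norm v * (\<Sum>b\<in>Basis. norm x * (c i b * N))"
      using component_le_norm_cart[of v i] by (auto intro!: mult_mono)
  qed
  also have "\<dots> = (\<Sum>i\<in>UNIV. \<Sum>b\<in>Basis. c i b) * N * norm v * norm x"
  proof -
    have "norm v * (\<Sum>b\<in>Basis. norm x * (c i b * N))
        = (\<Sum>b\<in>Basis. c i b) * (N * norm v * norm x)" for i
      unfolding sum_distrib_left sum_distrib_right by (rule sum.cong) auto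
    then have "(\<Sum>i\<in>UNIV. norm v * (\<Sum>b\<in>Basis. norm x * (c i b * N)))
        = (\<Sum>i\<in>UNIV. (\<Sum>b\<in>Basis. c i b) * (N * norm v * norm x))"
      by (simp only:)
    also have "\<dots> = (\<Sum>i\<in>UNIV. \<Sum>b\<in>Basis. c i b) * (N * norm v * norm x)"
      by (rule sum_distrib_right[symmetric])
    finally show ?thesis by (simp only: mult.assoc)
  qed
  finally show ?thesis .
qed

text \<open>Both parts come from expanding the linear argument in a basis, which turns a family of linear maps
  into finitely many vector-valued functions.\<close>
lemma has_derivative_linear_family:
  fixes A :: "'a::real_normed_vector \<Rightarrow> 'e::euclidean_space \<Rightarrow> 'b::real_normed_vector"
  assumes V: "open V" "S0 \<in> V" and lin: "\<And>S. S \<in> V \<Longrightarrow> linear (A S)"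
    and diff: "\<And>x. (\<lambda>S. A S x) differentiable (at S0)"
  shows "linear (\<lambda>x. frechet_derivative (\<lambda>S. A S x) (at S0) u)"
    and "T \<subseteq> s -` V \<Longrightarrow> t \<in> T \<Longrightarrow> s t = S0 \<Longrightarrow> (s has_derivative s') (at t within T) \<Longrightarrow>
      (y has_derivative y') (at t within T) \<Longrightarrow>
      ((\<lambda>t. A (s t) (y t)) has_derivative
        (\<lambda>h. frechet_derivative (\<lambda>S. A S (y t)) (at S0) (s' h) + A S0 (y' h))) (at t within T)"
proof -
  have D: "((\<lambda>S. A S x) has_derivative frechet_derivative (\<lambda>S. A S x) (at S0)) (at S0)" for x
    using diff by (simp add: frechet_derivative_works)
  have rep: "frechet_derivative (\<lambda>S. A S x) (at S0) u
      = (\<Sum>b\<in>Basis. (x \<bullet> b) *\<^sub>R frechet_derivative (\<lambda>S. A S b) (at S0) u)" for x u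
  proof -
    have "((\<lambda>S. \<Sum>b\<in>Basis. (x \<bullet> b) *\<^sub>R A S b) has_derivative
        (\<lambda>u. \<Sum>b\<in>Basis. (x \<bullet> b) *\<^sub>R frechet_derivative (\<lambda>S. A S b) (at S0) u)) (at S0)"
      by (intro has_derivative_sum has_derivative_scaleR_right D)
    then have "((\<lambda>S. A S x) has_derivative
        (\<lambda>u. \<Sum>b\<in>Basis. (x \<bullet> b) *\<^sub>R frechet_derivative (\<lambda>S. A S b) (at S0) u)) (at S0)"
      by (rule has_derivative_transform_within_open[OF _ V])
        (rule linear_eq_sum_Basis[OF lin, symmetric])
    from frechet_derivative_at[OF this] show ?thesis
      by (rule fun_cong[symmetric])
  qed
  have "linear (\<lambda>x. \<Sum>b\<in>Basis. (x \<bullet> b) *\<^sub>R frechet_derivative (\<lambda>S. A S b) (at S0) u)"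
    by (rule linearI)
      (simp_all add: inner_left_distrib scaleR_left_distrib sum.distrib scaleR_sum_right)
  moreover have "(\<lambda>x. frechet_derivative (\<lambda>S. A S x) (at S0) u)
      = (\<lambda>x. \<Sum>b\<in>Basis. (x \<bullet> b) *\<^sub>R frechet_derivative (\<lambda>S. A S b) (at S0) u)"
    by (rule ext) (rule rep)
  ultimately show "linear (\<lambda>x. frechet_derivative (\<lambda>S. A S x) (at S0) u)"
    by (rule back_subst[where P = linear, OF _ sym])
  assume T: "T \<subseteq> s -` V" "t \<in> T" "s t = S0" and s: "(s has_derivative s') (at t within T)"
    and y: "(y has_derivative y') (at t within T)"
  have "((\<lambda>t. A (s t) b) has_derivative (\<lambda>h. frechet_derivative (\<lambda>S. A S b) (at S0) (s' h)))
      (at t within T)" for b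
    using has_derivative_compose[OF s, of "\<lambda>S. A S b"] D[of b] T(3) by simp
  then have "((\<lambda>t. \<Sum>b\<in>Basis. (y t \<bullet> b) *\<^sub>R A (s t) b) has_derivative
      (\<lambda>h. \<Sum>b\<in>Basis. (y t \<bullet> b) *\<^sub>R frechet_derivative (\<lambda>S. A S b) (at S0) (s' h)
          + (y' h \<bullet> b) *\<^sub>R A (s t) b)) (at t within T)"
    by (intro has_derivative_sum has_derivative_scaleR has_derivative_inner_left y)
  moreover have "(\<Sum>b\<in>Basis. (y t \<bullet> b) *\<^sub>R frechet_derivative (\<lambda>S. A S b) (at S0) (s' h)
          + (y' h \<bullet> b) *\<^sub>R A (s t) b)
      = frechet_derivative (\<lambda>S. A S (y t)) (at S0) (s' h) + A S0 (y' h)" for h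
    unfolding rep[of "y t"] sum.distrib
    by (simp only: T(3) linear_eq_sum_Basis[OF lin[OF V(2)], symmetric])
  ultimately have "((\<lambda>t. \<Sum>b\<in>Basis. (y t \<bullet> b) *\<^sub>R A (s t) b) has_derivative
      (\<lambda>h. frechet_derivative (\<lambda>S. A S (y t)) (at S0) (s' h) + A S0 (y' h))) (at t within T)"
    by (simp only:)
  then show "((\<lambda>t. A (s t) (y t)) has_derivative
        (\<lambda>h. frechet_derivative (\<lambda>S. A S (y t)) (at S0) (s' h) + A S0 (y' h))) (at t within T)"
    by (rule has_derivative_transform[OF T(2), rotated])
      (use T(1) in \<open>auto intro!: linear_eq_sum_Basis lin\<close>)
qed

section \<open>Flat linear systems of partial differential equations\<close>

text \<open>A Frobenius theorem for \<open>\<partial>\<^sub>i X = A\<^sub>i X\<close>, global on a convex set.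
  Let \<open>B(S) v = \<Sum>\<^sub>i v\<^sub>i A\<^sub>i(S)\<close>. Along each ray from
  \<open>p\<close> to \<open>R\<close> the system is a linear ordinary differential equation, with
  solution \<open>y\<^sub>R\<close>, and \<open>X(R) = y\<^sub>R(1)\<close>. To see that
  \<open>X\<close> is differentiable, with the right derivative, compare two neighbouring rays: for
  \<open>R' = R + w\<close> and \<open>S = p + t (R - p)\<close>, the deviation \<open>F(t) =
  y\<^sub>R\<^sub>'(t) - y\<^sub>R(t) - t B(S) w y\<^sub>R(t)\<close> from the expected first-order
  behaviour satisfies a linear equation whose inhomogeneous part is quadratic in \<open>w\<close>,
  because flatness cancels exactly the terms of first order. By Gronwall's inequality
  \<open>F(1)\<close> is quadratic in \<open>w\<close>. Thus no theorem on the dependence of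
  solutions on parameters is needed, and smoothness follows afterwards by reading the equation for
  \<open>DX\<close> repeatedly.\<close>
theorem flat_linear_system_solution:
  fixes A :: "'n::finite \<Rightarrow> real^'n \<Rightarrow> 'e::euclidean_space \<Rightarrow> 'e"
  assumes V: "open V" "convex V" "p \<in> V"
    and lin: "\<And>i R. R \<in> V \<Longrightarrow> linear (A i R)"
    and smooth: "\<And>i x. smooth_on V (\<lambda>R. A i R x)"
    and flat: "\<And>R i j x. R \<in> V \<Longrightarrow>
      pd i (\<lambda>R. A j R x) R + A j R (A i R x) = pd j (\<lambda>R. A i R x) R + A i R (A j R x)"
  shows "\<exists>X. X p = x0 \<and> smooth_on V X \<and>
    (\<forall>R\<in>V. (X has_derivative (\<lambda>v. \<Sum>i\<in>UNIV. (v $ i) *\<^sub>R A i R (X R))) (at R))"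
proof -
  define B where "B S v x = (\<Sum>i\<in>UNIV. (v $ i) *\<^sub>R A i S x)" for S v x
  define dA where "dA i S u x = frechet_derivative (\<lambda>S. A i S x) (at S) u" for i S u x
  define DB where "DB S u v x = (\<Sum>i\<in>UNIV. (v $ i) *\<^sub>R dA i S u x)" for S u v x
  have C: "Ck_on k V (\<lambda>R. A i R x)" for i k x
    using smooth by (simp add: smooth_on_def)
  have diff: "(\<lambda>S. A i S x) differentiable (at R)" if "R \<in> V" for i x R
    using C[of "Suc 0" i x] that by simp
  have Acont: "continuous_on V (\<lambda>R. A i R x)" for i x
    using C[of 0 i x] by simp
  have lindA: "linear (dA i S u)" if "S \<in> V" for i S u
    unfolding dA_def by (rule has_derivative_linear_family[OF V(1) that lin diff[OF that]])
  have linB: "linear (B S v)" if "S \<in> V" for S v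
    unfolding B_def by (intro linear_compose_sum ballI linear_compose_scale_right lin that)
  have linBv: "B S (v + w) x = B S v x + B S w x" "B S (c *\<^sub>R v) x = c *\<^sub>R B S v x" "B S 0 x = 0"
    for S v w x c
    by (simp_all add: B_def scaleR_left_distrib sum.distrib scaleR_sum_right)
  have Bcont: "continuous_on V (\<lambda>S. B S v x)" for v x
    unfolding B_def by (intro continuous_intros Acont)
  have flatB: "DB S u v x + B S v (B S u x) = DB S v u x + B S u (B S v x)" if "S \<in> V" for S u v x
  proof -
    have e: "DB S u v x + B S v (B S u x) = (\<Sum>i\<in>UNIV. \<Sum>j\<in>UNIV. (v $ i * u $ j) *\<^sub>R
        (pd j (\<lambda>R. A i R x) S + A i S (A j S x)))" for u v
    proof -
      have "DB S u v x = (\<Sum>i\<in>UNIV. \<Sum>j\<in>UNIV. (v $ i * u $ j) *\<^sub>R pd j (\<lambda>R. A i R x) S)"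
        unfolding DB_def dA_def frechet_derivative_eq_sum_pd[OF diff[OF that]]
        by (simp add: scaleR_sum_right)
      moreover have "B S v (B S u x) = (\<Sum>i\<in>UNIV. \<Sum>j\<in>UNIV. (v $ i * u $ j) *\<^sub>R A i S (A j S x))"
        unfolding B_def
        by (simp add: linear_sum[OF lin[OF that]] linear_scale[OF lin[OF that]] scaleR_sum_right)
      ultimately show ?thesis by (simp add: sum.distrib scaleR_right_distrib)
    qed
    have "DB S u v x + B S v (B S u x) = (\<Sum>i\<in>UNIV. \<Sum>j\<in>UNIV. (v $ i * u $ j) *\<^sub>R
        (pd i (\<lambda>R. A j R x) S + A j S (A i S x)))"
      unfolding e flat[OF that] ..
    also have "\<dots> = (\<Sum>j\<in>UNIV. \<Sum>i\<in>UNIV. (v $ i * u $ j) *\<^sub>R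
        (pd i (\<lambda>R. A j R x) S + A j S (A i S x)))"
      by (rule sum.swap)
    also have "\<dots> = DB S v u x + B S u (B S v x)"
      unfolding e by (simp add: mult.commute)
    finally show ?thesis .
  qed
  have estimates: "\<exists>c\<ge>0. \<forall>S\<in>K. \<forall>S'\<in>K. \<forall>v x.
      norm (B S v x) \<le> c * norm v * norm x \<and>
      norm (B S' v x - B S v x) \<le> c * norm (S' - S) * norm v * norm x \<and>
      norm (B S' v x - B S v x - DB S (S' - S) v x) \<le> c * (norm (S' - S))\<^sup>2 * norm v * norm x"
    if K: "compact K" "convex K" "K \<subseteq> V" for K
  proof -
    have "\<exists>c\<ge>0. \<forall>S\<in>K. \<forall>S'\<in>K. norm (A i S b) \<le> c \<and>
       norm (A i S' b - A i S b) \<le> c * norm (S' - S) \<and>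
       norm (A i S' b - A i S b - dA i S (S' - S) b) \<le> c * (norm (S' - S))\<^sup>2" for i b
    proof -
      have "bounded ((\<lambda>S. A i S b) ` K)"
        using compact_imp_bounded compact_continuous_image[OF _ K(1)]
          continuous_on_subset[OF Acont K(3)] by blast
      then obtain c1 where c1: "\<forall>S\<in>K. norm (A i S b) \<le> c1"
        unfolding bounded_iff by blast
      obtain c2 where c2: "c2 \<ge> 0" "\<forall>S\<in>K. \<forall>S'\<in>K. norm (A i S' b - A i S b) \<le> c2 * norm (S' - S)"
        by (rule C1_lipschitz_on_compact[OF C K])
      obtain c3 where c3: "c3 \<ge> 0" "\<forall>S\<in>K. \<forall>S'\<in>K.
          norm (A i S' b - A i S b - dA i S (S' - S) b) \<le> c3 * (norm (S' - S))\<^sup>2"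
        unfolding dA_def by (rule C2_taylor_on_compact[OF C K])
      define c where "c = \<bar>c1\<bar> + c2 + c3"
      have cc: "c \<ge> c1" "c \<ge> c2" "c \<ge> c3" "c \<ge> 0" using c2(1) c3(1) by (auto simp: c_def)
      have "norm (A i S b) \<le> c" "norm (A i S' b - A i S b) \<le> c * norm (S' - S)"
        "norm (A i S' b - A i S b - dA i S (S' - S) b) \<le> c * (norm (S' - S))\<^sup>2"
        if "S \<in> K" "S' \<in> K" for S S'
      proof -
        show "norm (A i S b) \<le> c" using c1 that cc(1) by force
        show "norm (A i S' b - A i S b) \<le> c * norm (S' - S)"
          using c2(2) that mult_right_mono[OF cc(2), of "norm (S' - S)"] by force
        show "norm (A i S' b - A i S b - dA i S (S' - S) b) \<le> c * (norm (S' - S))\<^sup>2"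
          using c3(2) that mult_right_mono[OF cc(3), of "(norm (S' - S))\<^sup>2"] by force
      qed
      then show ?thesis using cc(4) by blast
    qed
    then obtain c where c: "\<And>i b. c i b \<ge> 0"
      "\<And>i b S S'. S \<in> K \<Longrightarrow> S' \<in> K \<Longrightarrow> norm (A i S b) \<le> c i b"
      "\<And>i b S S'. S \<in> K \<Longrightarrow> S' \<in> K \<Longrightarrow> norm (A i S' b - A i S b) \<le> c i b * norm (S' - S)"
      "\<And>i b S S'. S \<in> K \<Longrightarrow> S' \<in> K \<Longrightarrow>
        norm (A i S' b - A i S b - dA i S (S' - S) b) \<le> c i b * (norm (S' - S))\<^sup>2"
      by metis
    define M where "M = (\<Sum>i\<in>UNIV. \<Sum>b\<in>Basis. c i b)"
    have M0: "M \<ge> 0" unfolding M_def by (intro sum_nonneg c(1))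
    have "norm (B S v x) \<le> M * norm v * norm x \<and>
      norm (B S' v x - B S v x) \<le> M * norm (S' - S) * norm v * norm x \<and>
      norm (B S' v x - B S v x - DB S (S' - S) v x) \<le> M * (norm (S' - S))\<^sup>2 * norm v * norm x"
      if S: "S \<in> K" "S' \<in> K" for S S' v x
    proof -
      have SV: "S \<in> V" "S' \<in> V" using S K(3) by auto
      have "norm (B S v x) \<le> M * 1 * norm v * norm x"
        unfolding B_def M_def
        by (rule norm_bilinear_sum_le[OF lin[OF SV(1)]]) (use c(2)[OF S] in simp)
      moreover have "norm (B S' v x - B S v x) \<le> M * norm (S' - S) * norm v * norm x"
      proof -
        have "B S' v x - B S v x = (\<Sum>i\<in>UNIV. (v $ i) *\<^sub>R (A i S' x - A i S x))"
          by (simp add: B_def sum_subtractf scaleR_diff_right)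
        then show ?thesis unfolding M_def
          using norm_bilinear_sum_le[OF linear_compose_sub[OF lin[OF SV(2)] lin[OF SV(1)]] c(3)[OF S]]
          by simp
      qed
      moreover have "norm (B S' v x - B S v x - DB S (S' - S) v x)
          \<le> M * (norm (S' - S))\<^sup>2 * norm v * norm x"
      proof -
        have "B S' v x - B S v x - DB S (S' - S) v x
            = (\<Sum>i\<in>UNIV. (v $ i) *\<^sub>R (A i S' x - A i S x - dA i S (S' - S) x))"
          by (simp add: B_def DB_def sum_subtractf scaleR_diff_right)
        then show ?thesis unfolding M_def
          using norm_bilinear_sum_le[OF linear_compose_sub[OF linear_compose_sub[OF lin[OF SV(2)]
                lin[OF SV(1)]] lindA[OF SV(1)]] c(4)[OF S]]
          by simp
      qed
      ultimately show ?thesis by simp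
    qed
    then show ?thesis using M0 by blast
  qed
  have segV: "p + t *\<^sub>R (R - p) \<in> K" if "R \<in> K" "t \<in> {0..1}" "convex K" "p \<in> K" for R t K
  proof -
    have "p + t *\<^sub>R (R - p) = (1 - t) *\<^sub>R p + t *\<^sub>R R" by (simp add: algebra_simps)
    then show ?thesis using convexD_alt[OF that(3,4,1), of t] that(2) by simp
  qed
  have "\<exists>y. y 0 = x0 \<and> (\<forall>t\<in>{0..1}. (y has_vector_derivative
      B (p + t *\<^sub>R (R - p)) (R - p) (y t)) (at t within {0..1}))" if "R \<in> V" for R
  proof -
    have ray: "p + t *\<^sub>R (R - p) \<in> V" if "t \<in> {0..1}" for t
      by (rule segV[OF \<open>R \<in> V\<close> that V(2,3)])
    have "continuous_on {0..1} (\<lambda>t. B (p + t *\<^sub>R (R - p)) (R - p) x)" for x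
      by (rule continuous_on_compose2[OF Bcont]) (use ray in \<open>auto intro!: continuous_intros\<close>)
    then obtain y where "y 0 = x0" "\<And>t. t \<in> {0..1} \<Longrightarrow>
        (y has_vector_derivative B (p + t *\<^sub>R (R - p)) (R - p) (y t)) (at t within {0..1})"
      using linear_ode_exists[of "\<lambda>t. B (p + t *\<^sub>R (R - p)) (R - p)" x0] linB[OF ray] by blast
    then show ?thesis by blast
  qed
  then obtain y where y0: "\<And>R. R \<in> V \<Longrightarrow> y R 0 = x0"
    and y: "\<And>R t. R \<in> V \<Longrightarrow> t \<in> {0..1} \<Longrightarrow> (y R has_vector_derivative
      B (p + t *\<^sub>R (R - p)) (R - p) (y R t)) (at t within {0..1})"
    by metis
  define X where "X R = y R 1" for R
  have Xp: "X p = x0"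
  proof -
    have "norm (y p 1 - x0) \<le> 0 * exp (0 + 1)"
    proof (rule linear_ode_gronwall[where F = "\<lambda>t. y p t - x0" and F' = "\<lambda>t. 0"])
      fix t :: real assume "t \<in> {0..1}"
      from y[OF V(3) this] show "((\<lambda>t. y p t - x0) has_vector_derivative 0) (at t within {0..1})"
        by (auto intro!: derivative_eq_intros simp: linBv)
    qed (use y0[OF V(3)] in auto)
    then show ?thesis by (simp add: X_def)
  qed
  have XD: "(X has_derivative (\<lambda>v. \<Sum>i\<in>UNIV. (v $ i) *\<^sub>R A i R (X R))) (at R)" if R: "R \<in> V" for R
  proof -
    obtain \<delta> where \<delta>: "\<delta> > 0" "cball R \<delta> \<subseteq> V"
      using V(1) R by (auto simp: open_contains_cball)
    \<comment> \<open>A single compact convex set that contains the rays to all points near \<open>R\<close>, so that the constants below do not depend on \<open>R'\<close>.\<close>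
    define K where "K = convex hull (insert p (cball R \<delta>))"
    have K: "compact K" "convex K" "K \<subseteq> V"
      unfolding K_def using \<delta>(2) V(2,3)
      by (auto intro!: compact_convex_hull compact_insert hull_minimal del: subsetI)
    have inK: "p \<in> K" "\<And>R'. norm (R' - R) \<le> \<delta> \<Longrightarrow> R' \<in> K"
      unfolding K_def by (auto intro!: hull_inc simp: dist_norm norm_minus_commute)
    obtain c where c: "c \<ge> 0" and
      est: "\<And>S S' v x. S \<in> K \<Longrightarrow> S' \<in> K \<Longrightarrow> norm (B S v x) \<le> c * norm v * norm x"
      "\<And>S S' v x. S \<in> K \<Longrightarrow> S' \<in> K \<Longrightarrow> norm (B S' v x - B S v x) \<le> c * norm (S' - S) * norm v * norm x"
      "\<And>S S' v x. S \<in> K \<Longrightarrow> S' \<in> K \<Longrightarrow> norm (B S' v x - B S v x - DB S (S' - S) v x)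
        \<le> c * (norm (S' - S))\<^sup>2 * norm v * norm x"
      using estimates[OF K] by blast
    define q where "q = R - p"
    have "continuous_on {0..1} (y R)" using y[OF R] by (rule continuous_on_vector_derivative)
    then have "bounded (y R ` {0..1})"
      by (intro compact_imp_bounded compact_continuous_image compact_Icc)
    then obtain m where m: "\<And>t. t \<in> {0..1} \<Longrightarrow> norm (y R t) \<le> m"
      unfolding bounded_iff by blast
    define k where "k = norm q"
    have k: "k \<ge> 0" by (simp add: k_def)
    have m0: "m \<ge> 0" using m[of 0] norm_ge_zero[of "y R 0"] by (simp del: norm_ge_zero)
    define Q where "Q = c * m * (k + 1 + c * k + c) * exp (c * (k + 1) + 1)"
    have Q: "Q \<ge> 0" unfolding Q_def using c m0 k by simp
    have main: "norm (X R' - X R - B R (R' - R) (X R)) \<le> Q * (norm (R' - R))\<^sup>2"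
      if R': "norm (R' - R) \<le> \<delta>" "norm (R' - R) \<le> 1" for R'
    proof -
      define w where "w = R' - R"
      have R'V: "R' \<in> V" using inK(2)[OF R'(1)] K(3) by blast
      define S where "S t = p + t *\<^sub>R q" for t
      define S' where "S' t = p + t *\<^sub>R (q + w)" for t
      have qw: "R - p = q" "R' - p = q + w" by (simp_all add: q_def w_def)
      have SK: "S t \<in> K" "S' t \<in> K" if "t \<in> {0..1}" for t
        using segV[OF inK(2)[OF R'(1)] that K(2) inK(1)] segV[OF inK(2) that K(2) inK(1), of R] \<delta>(1)
        unfolding qw S_def S'_def by auto
      define F where "F t = y R' t - y R t - t *\<^sub>R B (S t) w (y R t)" for t
      define F' where "F' t = B (S' t) (q + w) (y R' t) - B (S t) q (y R t)
        - (B (S t) w (y R t) + t *\<^sub>R (DB (S t) q w (y R t) + B (S t) w (B (S t) q (y R t))))" for t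
      have "norm (F 1) \<le> (c * m * (k + 1 + c * k + c) * (norm w)\<^sup>2) * exp (c * (k + 1) + 1)"
      proof (rule linear_ode_gronwall[where F' = F'])
        fix t :: real assume t: "t \<in> {0..1}"
        have SV: "S t \<in> V" "S' t \<in> V" using SK[OF t] K(3) by auto
        have Sd: "(S has_derivative (\<lambda>h. h *\<^sub>R q)) (at t within {0..1})"
          unfolding S_def by (auto intro!: derivative_eq_intros)
        have yd: "(y R has_derivative (\<lambda>h. h *\<^sub>R B (S t) q (y R t))) (at t within {0..1})"
          using y[OF R t] unfolding has_vector_derivative_def qw S_def .
        have SVs: "{0..1} \<subseteq> S -` V" using SK K(3) by blast
        have "((\<lambda>t. A i (S t) (y R t)) has_derivative
            (\<lambda>h. dA i (S t) (h *\<^sub>R q) (y R t) + A i (S t) (h *\<^sub>R B (S t) q (y R t)))) (at t within {0..1})"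
          for i unfolding dA_def
          by (rule has_derivative_linear_family(2)[OF V(1) SV(1) lin diff[OF SV(1)] SVs t refl Sd yd])
        then have "((\<lambda>t. B (S t) w (y R t)) has_derivative
            (\<lambda>h. \<Sum>i\<in>UNIV. (w $ i) *\<^sub>R
              (dA i (S t) (h *\<^sub>R q) (y R t) + A i (S t) (h *\<^sub>R B (S t) q (y R t))))) (at t within {0..1})"
          unfolding B_def[of _ w] by (intro has_derivative_sum has_derivative_scaleR_right)
        moreover have "(\<Sum>i\<in>UNIV. (w $ i) *\<^sub>R
              (dA i (S t) (h *\<^sub>R q) (y R t) + A i (S t) (h *\<^sub>R B (S t) q (y R t))))
            = h *\<^sub>R (DB (S t) q w (y R t) + B (S t) w (B (S t) q (y R t)))" for h
        proof -
          have "dA i (S t) (h *\<^sub>R q) x = h *\<^sub>R dA i (S t) q x" for i x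
            unfolding dA_def using linear_frechet_derivative[OF diff[OF SV(1)]] by (rule linear_scale)
          then show ?thesis
            by (simp add: linear_scale[OF lin[OF SV(1)]] DB_def B_def[of _ w] sum.distrib
                scaleR_right_distrib scaleR_sum_right mult.commute)
        qed
        ultimately have "((\<lambda>t. B (S t) w (y R t)) has_vector_derivative
            DB (S t) q w (y R t) + B (S t) w (B (S t) q (y R t))) (at t within {0..1})"
          by (simp only: has_vector_derivative_def)
        then have "((\<lambda>t. t *\<^sub>R B (S t) w (y R t)) has_vector_derivative
            t *\<^sub>R (DB (S t) q w (y R t) + B (S t) w (B (S t) q (y R t))) + 1 *\<^sub>R B (S t) w (y R t))
            (at t within {0..1})"
          by (intro has_vector_derivative_scaleR) (auto intro!: derivative_eq_intros)
        moreover have "(y R has_vector_derivative B (S t) q (y R t)) (at t within {0..1})"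
          "(y R' has_vector_derivative B (S' t) (q + w) (y R' t)) (at t within {0..1})"
          using y[OF R t] y[OF R'V t] unfolding qw S_def S'_def .
        ultimately have "(F has_vector_derivative B (S' t) (q + w) (y R' t) - B (S t) q (y R t) -
            (t *\<^sub>R (DB (S t) q w (y R t) + B (S t) w (B (S t) q (y R t))) + 1 *\<^sub>R B (S t) w (y R t)))
            (at t within {0..1})"
          unfolding F_def by (intro has_vector_derivative_diff)
        then show "(F has_vector_derivative F' t) (at t within {0..1})"
          unfolding F'_def by (simp add: add.commute)
        let ?Y = "y R t" and ?S = "S t" and ?S' = "S' t"
        define z where "z = B ?S w ?Y"
        have SS': "?S' - ?S = t *\<^sub>R w" by (simp add: S_def S'_def algebra_simps)
        have nSS': "norm (?S' - ?S) \<le> norm w"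
          unfolding SS' using t by (simp add: mult_left_le_one_le)
        have DBs: "DB ?S (t *\<^sub>R w) q ?Y = t *\<^sub>R DB ?S w q ?Y"
        proof -
          have "dA i ?S (t *\<^sub>R w) x = t *\<^sub>R dA i ?S w x" for i x
            unfolding dA_def using linear_frechet_derivative[OF diff[OF SV(1)]] by (rule linear_scale)
          then show ?thesis by (simp add: DB_def scaleR_sum_right mult.commute)
        qed
        \<comment> \<open>\<open>F' = B(S') (q + w) F + G\<close> with \<open>G = G1 + G2 + t (G3 + G4)\<close>: each \<open>Gi\<close> is quadratic in \<open>w\<close>, and \<open>fl\<close> below is where flatness enters.\<close>
        define G1 where "G1 = B ?S' q ?Y - B ?S q ?Y - DB ?S (?S' - ?S) q ?Y"
        define G2 where "G2 = B ?S' w ?Y - B ?S w ?Y"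
        define G3 where "G3 = B ?S' q z - B ?S q z"
        define G4 where "G4 = B ?S' w z"
        have yF: "y R' t = F t + ?Y + t *\<^sub>R z" by (simp add: F_def z_def)
        have fl: "DB ?S q w ?Y + B ?S w (B ?S q ?Y) = DB ?S w q ?Y + B ?S q z"
          unfolding z_def by (rule flatB[OF SV(1)])
        have F'eq: "F' t = B ?S' (q + w) (F t) + (G1 + G2 + t *\<^sub>R (G3 + G4))"
          unfolding F'_def fl yF G1_def G2_def G3_def G4_def SS' DBs z_def[symmetric]
            linear_add[OF linB[OF SV(2)]] linear_scale[OF linB[OF SV(2)]] linBv
          by (simp add: algebra_simps)
        have nz: "norm z \<le> c * norm w * m"
          unfolding z_def using est(1)[OF SK[OF t], of w ?Y] m[OF t] c
          by (smt (verit) mult_left_mono mult_nonneg_nonneg norm_ge_zero)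
        have "norm G1 \<le> c * (norm w)\<^sup>2 * k * m"
          unfolding G1_def k_def using c m0 m[OF t] nSS'
          by (intro order_trans[OF est(3)[OF SK[OF t]]] mult_mono power_mono mult_nonneg_nonneg) auto
        moreover have "norm G2 \<le> c * norm w * norm w * m"
          unfolding G2_def using c m0 m[OF t] nSS'
          by (intro order_trans[OF est(2)[OF SK[OF t]]] mult_mono mult_nonneg_nonneg) auto
        moreover have "norm G3 \<le> c * norm w * k * (c * norm w * m)"
          unfolding G3_def k_def using c m0 nz nSS'
          by (intro order_trans[OF est(2)[OF SK[OF t]]] mult_mono mult_nonneg_nonneg) auto
        moreover have "norm G4 \<le> c * norm w * (c * norm w * m)"
          unfolding G4_def using c m0 nz
          by (intro order_trans[OF est(1)[OF SK(2)[OF t] SK(2)[OF t]]] mult_mono mult_nonneg_nonneg) auto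
        moreover have "norm (t *\<^sub>R (G3 + G4)) \<le> norm G3 + norm G4"
          using t norm_triangle_ineq[of G3 G4] mult_left_le_one_le[of "norm (G3 + G4)" t] by auto
        ultimately have G: "norm (G1 + G2 + t *\<^sub>R (G3 + G4)) \<le> c * (norm w)\<^sup>2 * k * m + c * norm w * norm w * m
            + c * norm w * k * (c * norm w * m) + c * norm w * (c * norm w * m)"
          by (smt (verit) norm_triangle_ineq)
        have "norm (B ?S' (q + w) (F t)) \<le> c * (k + 1) * norm (F t)"
          using c R'(2) norm_triangle_ineq[of q w]
          by (intro order_trans[OF est(1)[OF SK(2)[OF t] SK(2)[OF t]]] mult_mono mult_nonneg_nonneg)
            (auto simp: k_def w_def)
        with G show "norm (F' t) \<le> c * (k + 1) * norm (F t) + c * m * (k + 1 + c * k + c) * (norm w)\<^sup>2"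
          unfolding F'eq using norm_triangle_ineq[of "B ?S' (q + w) (F t)" "G1 + G2 + t *\<^sub>R (G3 + G4)"]
          by (simp add: algebra_simps power2_eq_square)
      qed (use c k y0[OF R] y0[OF R'V] in \<open>auto simp: F_def\<close>)
      moreover have "F 1 = X R' - X R - B R (R' - R) (X R)"
        by (simp add: F_def S_def X_def q_def w_def)
      ultimately show ?thesis by (simp add: Q_def w_def mult_ac)
    qed
    have "(X has_derivative (\<lambda>v. B R v (X R))) (at R)"
      unfolding has_derivative_at_alt
    proof (intro conjI allI impI)
      have "linear (\<lambda>v. B R v (X R))" by (rule linearI) (simp_all add: linBv)
      then show "bounded_linear (\<lambda>v. B R v (X R))" by (simp add: linear_conv_bounded_linear)
      fix e :: real assume e: "e > 0"
      define d where "d = min (min \<delta> 1) (e / (Q + 1))"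
      have d: "d > 0" using \<delta>(1) e Q by (simp add: d_def)
      have "norm (X R' - X R - B R (R' - R) (X R)) \<le> e * norm (R' - R)" if "norm (R' - R) < d" for R'
      proof -
        have l: "norm (R' - R) \<le> \<delta>" "norm (R' - R) \<le> 1" "norm (R' - R) \<le> e / (Q + 1)"
          using that by (auto simp: d_def)
        have "Q * norm (R' - R) \<le> (Q + 1) * (e / (Q + 1))"
          using l(3) Q e by (intro mult_mono) auto
        then have "Q * norm (R' - R) * norm (R' - R) \<le> e * norm (R' - R)"
          using Q by (intro mult_right_mono) auto
        then show ?thesis using main[OF l(1,2)] by (simp add: power2_eq_square mult.assoc)
      qed
      then show "\<exists>d>0. \<forall>R'. norm (R' - R) < d \<longrightarrow>
          norm (X R' - X R - B R (R' - R) (X R)) \<le> e * norm (R' - R)"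
        using d by blast
    qed
    then show ?thesis by (simp only: B_def)
  qed
  have "Ck_on k V X" for k
  proof (induction k)
    case 0
    have "continuous_on V X"
      using XD by (rule has_derivative_continuous_on[OF has_derivative_at_withinI])
    then show ?case by simp
  next
    case (Suc k)
    show ?case
    proof (rule Ck_on_Suc[OF V(1) XD])
      fix v
      have "Ck_on k V (\<lambda>R. \<Sum>i\<in>UNIV. (v $ i) *\<^sub>R (\<Sum>b\<in>Basis. (X R \<bullet> b) *\<^sub>R A i R b))"
        using Suc.IH
        by (intro Ck_on_sum[OF V(1)] Ck_on_scaleR[OF V(1)] Ck_on_const[OF V(1)] C
            Ck_on_linear[OF V(1) bounded_linear_inner_left])
      then show "Ck_on k V (\<lambda>R. \<Sum>i\<in>UNIV. (v $ i) *\<^sub>R A i R (X R))"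
        by (rule Ck_on_cong[OF V(1), THEN iffD1, rotated])
          (simp add: linear_eq_sum_Basis[OF lin, symmetric])
    qed
  qed
  then have "smooth_on V X" by (simp add: smooth_on_def)
  with Xp XD show ?thesis by blast
qed

section \<open>The Lame equations\<close>

text \<open>The coefficient operator of the frame equations, on pairs of a frame \<open>\<Phi>\<close> (the
  rows \<open>\<phi>\<^sub>1, \<dots>, \<phi>\<^sub>n\<close>) and a position vector:
  \<open>\<partial>\<^sub>j (\<Phi>, r)\<close> is its value with \<open>c m =
  b\<^sub>m\<^sub>j\<close> and \<open>d = h\<^sub>j\<close>. Each summand of the first component is
  the infinitesimal rotation in the plane of the directions \<open>m\<close> and \<open>j\<close>.
  Keeping \<open>r\<close> in the unknown makes the integration of the frame and that of the closed
  form \<open>\<Sum>\<^sub>i h\<^sub>i \<phi>\<^sub>i dR\<^sub>i\<close> a single linear problem.\<close>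
definition frame_field :: "('n::finite \<Rightarrow> real) \<Rightarrow> real \<Rightarrow> 'n \<Rightarrow> ((real^'n)^'n) \<times> (real^'n) \<Rightarrow> ((real^'n)^'n) \<times> (real^'n)" where
  "frame_field c d j x = (\<Sum>m\<in>UNIV - {j}. c m *\<^sub>R (axis m (fst x $ j) - axis j (fst x $ m), 0))
      + d *\<^sub>R (0, fst x $ j)"

lemma frame_field_components:
  "fst (frame_field c d j x) $ m =
    (if m = j then - (\<Sum>k\<in>UNIV - {j}. c k *\<^sub>R (fst x $ k)) else c m *\<^sub>R (fst x $ j))"
  "snd (frame_field c d j x) = d *\<^sub>R (fst x $ j)"
proof -
  have "fst (frame_field c d j x) $ m =
      (\<Sum>k\<in>UNIV - {j}. c k *\<^sub>R ((if m = k then fst x $ j else 0) - (if m = j then fst x $ k else 0)))"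
    by (simp add: frame_field_def fst_sum axis_def)
  also have "\<dots> = (if m = j then - (\<Sum>k\<in>UNIV - {j}. c k *\<^sub>R (fst x $ k)) else c m *\<^sub>R (fst x $ j))"
  proof (cases "m = j")
    case True
    then have "(\<Sum>k\<in>UNIV - {j}. c k *\<^sub>R ((if m = k then fst x $ j else 0) - (if m = j then fst x $ k else 0)))
        = (\<Sum>k\<in>UNIV - {j}. - (c k *\<^sub>R (fst x $ k)))"
      by (intro sum.cong) auto
    with True show ?thesis by (simp add: sum_negf)
  next
    case False
    then have "(\<Sum>k\<in>UNIV - {j}. c k *\<^sub>R ((if m = k then fst x $ j else 0) - (if m = j then fst x $ k else 0)))
        = (\<Sum>k\<in>UNIV - {j}. if k = m then c m *\<^sub>R (fst x $ j) else 0)"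
      by (intro sum.cong) auto
    with False show ?thesis by simp
  qed
  finally show "fst (frame_field c d j x) $ m =
    (if m = j then - (\<Sum>k\<in>UNIV - {j}. c k *\<^sub>R (fst x $ k)) else c m *\<^sub>R (fst x $ j))" .
  show "snd (frame_field c d j x) = d *\<^sub>R (fst x $ j)"
    by (simp add: frame_field_def snd_sum)
qed

lemma linear_frame_field: "linear (frame_field c d j)"
proof (rule linearI)
  show "frame_field c d j (x + y) = frame_field c d j x + frame_field c d j y" for x y
    by (intro prod_eqI vec_eq_iff[THEN iffD2] allI)
      (simp_all add: frame_field_components scaleR_right_distrib sum.distrib)
  show "frame_field c d j (a *\<^sub>R x) = a *\<^sub>R frame_field c d j x" for a x
    by (intro prod_eqI vec_eq_iff[THEN iffD2] allI)
      (simp_all add: frame_field_components sum_distrib_left mult_ac)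
qed

text \<open>The compatibility conditions of the frame equations, at one point; \<open>Di k j\<close> and
  \<open>Dj k i\<close> stand for \<open>\<partial>\<^sub>i b\<^sub>k\<^sub>j\<close> and
  \<open>\<partial>\<^sub>j b\<^sub>k\<^sub>i\<close>. In the position vector both sides are equal
  by symmetry, since \<open>\<partial>\<^sub>i h\<^sub>j = b\<^sub>i\<^sub>j h\<^sub>i\<close> has
  been inserted, and in the rows \<open>m \<noteq> i, j\<close> by the equations for distinct
  indices; the rows \<open>i\<close> and \<open>j\<close>, exchanged by symmetry, require the
  remaining equation \<open>lame\<close>.\<close>
lemma lame_flatness:
  fixes b Di Dj :: "'n::finite \<Rightarrow> 'n \<Rightarrow> real" and h :: "'n \<Rightarrow> real"
  assumes ij: "i \<noteq> j"
    and Di: "\<And>k. k \<noteq> i \<Longrightarrow> k \<noteq> j \<Longrightarrow> Di k j = b k i * b i j"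
    and Dj: "\<And>k. k \<noteq> i \<Longrightarrow> k \<noteq> j \<Longrightarrow> Dj k i = b k j * b j i"
    and lame: "Di i j + Dj j i + (\<Sum>k\<in>UNIV - {i, j}. b k i * b k j) = 0"
  defines "A \<equiv> \<lambda>j. frame_field (\<lambda>m. b m j) (h j) j"
  shows "frame_field (\<lambda>m. Di m j) (b i j * h i) j x + A j (A i x)
    = frame_field (\<lambda>m. Dj m i) (b j i * h j) i x + A i (A j x)"
proof -
  \<comment> \<open>Stated for arbitrary \<open>i\<close> and \<open>j\<close>, so that it can be used with the two exchanged.\<close>
  have key: "fst (frame_field (\<lambda>m. Di m j) (b i j * h i) j x + A j (A i x)) $ j
    = fst (frame_field (\<lambda>m. Dj m i) (b j i * h j) i x + A i (A j x)) $ j"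
    if ij: "i \<noteq> j"
    and Di: "\<And>k. k \<noteq> i \<Longrightarrow> k \<noteq> j \<Longrightarrow> Di k j = b k i * b i j"
    and lame: "Di i j + Dj j i + (\<Sum>k\<in>UNIV - {i, j}. b k i * b k j) = 0"
    for i j and Di Dj :: "'n \<Rightarrow> 'n \<Rightarrow> real"
  proof -
    let ?F = "\<lambda>k. fst x $ k"
    have spl: "(\<Sum>k\<in>UNIV - {j}. f k) = f i + (\<Sum>k\<in>UNIV - {i, j}. f k)" for f :: "'n \<Rightarrow> real^'n"
    proof -
      have "UNIV - {j} = insert i (UNIV - {i, j})" using ij by auto
      then show ?thesis by simp
    qed
    have spl': "(\<Sum>k\<in>UNIV - {i}. f k) = f j + (\<Sum>k\<in>UNIV - {i, j}. f k)" for f :: "'n \<Rightarrow> real^'n"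
    proof -
      have "UNIV - {i} = insert j (UNIV - {i, j})" using ij by auto
      then show ?thesis by simp
    qed
    have s1: "(\<Sum>k\<in>UNIV - {i, j}. Di k j *\<^sub>R ?F k) = b i j *\<^sub>R (\<Sum>k\<in>UNIV - {i, j}. b k i *\<^sub>R ?F k)"
      unfolding scaleR_sum_right by (rule sum.cong) (auto simp: Di)
    have Ai: "fst (A i x) $ k = b k i *\<^sub>R ?F i" if "k \<in> UNIV - {i, j}" for k
      using that by (simp add: A_def frame_field_components)
    have s2: "(\<Sum>k\<in>UNIV - {i, j}. b k j *\<^sub>R fst (A i x) $ k)
        = (\<Sum>k\<in>UNIV - {i, j}. b k i * b k j) *\<^sub>R ?F i"
      unfolding scaleR_sum_left by (rule sum.cong) (simp_all add: Ai)
    have Dj: "Dj j i = - Di i j - (\<Sum>k\<in>UNIV - {i, j}. b k i * b k j)"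
      using lame by simp
    have Aj: "A j y = frame_field (\<lambda>m. b m j) (h j) j y" for y
      by (simp add: A_def)
    have "fst (frame_field (\<lambda>m. Di m j) (b i j * h i) j x + A j (A i x)) $ j
        = - (Di i j *\<^sub>R ?F i + b i j *\<^sub>R (\<Sum>k\<in>UNIV - {i, j}. b k i *\<^sub>R ?F k))
          - (b i j *\<^sub>R fst (A i x) $ i + (\<Sum>k\<in>UNIV - {i, j}. b k i * b k j) *\<^sub>R ?F i)"
      unfolding Aj by (simp add: frame_field_components spl s1 s2)
    also have "fst (A i x) $ i = - (b j i *\<^sub>R ?F j + (\<Sum>k\<in>UNIV - {i, j}. b k i *\<^sub>R ?F k))"
      by (simp add: A_def frame_field_components spl')
    also have "- (Di i j *\<^sub>R ?F i + b i j *\<^sub>R (\<Sum>k\<in>UNIV - {i, j}. b k i *\<^sub>R ?F k))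
          - (b i j *\<^sub>R (- (b j i *\<^sub>R ?F j + (\<Sum>k\<in>UNIV - {i, j}. b k i *\<^sub>R ?F k)))
            + (\<Sum>k\<in>UNIV - {i, j}. b k i * b k j) *\<^sub>R ?F i)
        = Dj j i *\<^sub>R ?F i + b j i *\<^sub>R (b i j *\<^sub>R ?F j)"
      unfolding Dj by (simp add: algebra_simps)
    also have "\<dots> = fst (frame_field (\<lambda>m. Dj m i) (b j i * h j) i x + A i (A j x)) $ j"
      using ij by (simp add: A_def frame_field_components)
    finally show ?thesis .
  qed
  show ?thesis
  proof (rule prod_eqI)
    show "snd (frame_field (\<lambda>m. Di m j) (b i j * h i) j x + A j (A i x))
        = snd (frame_field (\<lambda>m. Dj m i) (b j i * h j) i x + A i (A j x))"
      using ij by (simp add: A_def frame_field_components mult.commute)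
    have "fst (frame_field (\<lambda>m. Di m j) (b i j * h i) j x + A j (A i x)) $ m
        = fst (frame_field (\<lambda>m. Dj m i) (b j i * h j) i x + A i (A j x)) $ m" for m
    proof -
      consider "m = i" | "m = j" | "m \<noteq> i" "m \<noteq> j" by blast
      then show ?thesis
      proof cases
        case 1
        have "Dj j i + Di i j + (\<Sum>k\<in>UNIV - {j, i}. b k j * b k i) = 0"
          using lame by (simp add: insert_commute mult.commute add.commute)
        with 1 key[of j i Dj Di] ij Dj show ?thesis by simp
      next
        case 2
        with key[of i j Di Dj] ij Di lame show ?thesis by simp
      next
        case 3
        then show ?thesis
          using ij by (simp add: A_def frame_field_components Di Dj)
      qed
    qed
    then show "fst (frame_field (\<lambda>m. Di m j) (b i j * h i) j x + A j (A i x))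
        = fst (frame_field (\<lambda>m. Dj m i) (b j i * h j) i x + A i (A j x))"
      by (rule vec_eq_iff[THEN iffD2, OF allI])
  qed
qed

text \<open>The classical integration of the Lame equations. The frame equations are flat, hence have a
  solution with orthonormal initial value. Their coefficients are skew, so \<open>\<Phi>\<^sup>T
  \<Phi>\<close> is constant: differentiating it only uses skewness in the row index, whereas
  \<open>\<Phi> \<Phi>\<^sup>T\<close> would satisfy a differential equation that still has to be
  solved. A square matrix with \<open>\<Phi>\<^sup>T \<Phi> = 1\<close> has orthonormal rows too.\<close>
theorem lame_system_solution:
  fixes b :: "'n::finite \<Rightarrow> 'n \<Rightarrow> real^'n \<Rightarrow> real" and h :: "'n \<Rightarrow> real^'n \<Rightarrow> real"
  assumes V: "open V" "convex V"
    and sb: "\<And>i j. i \<noteq> j \<Longrightarrow> smooth_on V (b i j)" and sh: "\<And>i. smooth_on V (h i)"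
    and dh: "\<And>R i j. R \<in> V \<Longrightarrow> i \<noteq> j \<Longrightarrow> pd i (h j) R = b i j R * h i R"
    and db: "\<And>R i j k. R \<in> V \<Longrightarrow> i \<noteq> j \<Longrightarrow> i \<noteq> k \<Longrightarrow> j \<noteq> k \<Longrightarrow>
      pd k (b i j) R = b i k R * b k j R"
    and lame: "\<And>R i j. R \<in> V \<Longrightarrow> i \<noteq> j \<Longrightarrow>
      pd i (b i j) R + pd j (b j i) R + (\<Sum>k\<in>UNIV - {i, j}. b k i R * b k j R) = 0"
  shows "\<exists>(\<phi> :: 'n \<Rightarrow> real^'n \<Rightarrow> real^'n) (r :: real^'n \<Rightarrow> real^'n).
    (\<forall>i. smooth_on V (\<phi> i)) \<and> smooth_on V r \<and>
    (\<forall>R\<in>V. orthonormal_frame (\<lambda>i. \<phi> i R)) \<and>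
    (\<forall>R\<in>V. \<forall>i j. j \<noteq> i \<longrightarrow> pd j (\<phi> i) R = b i j R *\<^sub>R \<phi> j R) \<and>
    (\<forall>R\<in>V. \<forall>i. pd i (\<phi> i) R = - (\<Sum>k\<in>UNIV - {i}. b k i R *\<^sub>R \<phi> k R)) \<and>
    (\<forall>R\<in>V. \<forall>i. pd i r R = h i R *\<^sub>R \<phi> i R)"
proof (cases "V = {}")
  case True
  show ?thesis
    by (rule exI[of _ "\<lambda>i R. 0"], rule exI[of _ "\<lambda>R. 0"])
      (simp add: True smooth_on_def Ck_on_const)
next
  case False
  then obtain p where p: "p \<in> V" by blast
  define A where "A j R = frame_field (\<lambda>m. b m j R) (h j R) j" for j R
  have Cb: "Ck_on k V (b i j)" if "i \<noteq> j" for k i j using sb[OF that] by (simp add: smooth_on_def)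
  have Ch: "Ck_on k V (h i)" for k i using sh by (simp add: smooth_on_def)
  have pdA: "pd i (\<lambda>R. A j R x) R = frame_field (\<lambda>m. pd i (b m j) R) (pd i (h j) R) j x"
    if "R \<in> V" for i j x R
  proof -
    have D: "(b m j has_derivative frechet_derivative (b m j) (at R)) (at R)" if "m \<in> UNIV - {j}" for m
      by (rule Ck_on_has_derivative[OF Cb[of m j 1, unfolded One_nat_def] \<open>R \<in> V\<close>]) (use that in auto)
    have "((\<lambda>R. A j R x) has_derivative (\<lambda>v.
        (\<Sum>m\<in>UNIV - {j}. frechet_derivative (b m j) (at R) v *\<^sub>R (axis m (fst x $ j) - axis j (fst x $ m), 0))
        + frechet_derivative (h j) (at R) v *\<^sub>R (0, fst x $ j))) (at R)"
      unfolding A_def frame_field_def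
      by (intro has_derivative_add has_derivative_sum has_derivative_scaleR_left D
          Ck_on_has_derivative[OF Ch[of "Suc 0"] that])
    from pd_eqI[OF this] show ?thesis by (simp add: frame_field_def pd_def)
  qed
  have "\<exists>X. X p = (mat 1, 0) \<and> smooth_on V X \<and>
      (\<forall>R\<in>V. (X has_derivative (\<lambda>v. \<Sum>i\<in>UNIV. (v $ i) *\<^sub>R A i R (X R))) (at R))"
  proof (rule flat_linear_system_solution[OF V p])
    show "linear (A i R)" for i R
      unfolding A_def by (rule linear_frame_field)
    show "smooth_on V (\<lambda>R. A i R x)" for i x
      unfolding smooth_on_def A_def frame_field_def
      by (intro allI Ck_on_add[OF V(1)] Ck_on_sum[OF V(1)] Ck_on_scaleR[OF V(1)] Ck_on_const[OF V(1)] Cb Ch)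
        auto
    show "pd i (\<lambda>R. A j R x) R + A j R (A i R x) = pd j (\<lambda>R. A i R x) R + A i R (A j R x)"
      if R: "R \<in> V" for R i j x
    proof (cases "i = j")
      case False
      have "k \<noteq> i \<Longrightarrow> k \<noteq> j \<Longrightarrow> pd i (b k j) R = b k i R * b i j R"
        "k \<noteq> i \<Longrightarrow> k \<noteq> j \<Longrightarrow> pd j (b k i) R = b k j R * b j i R" for k
        using db[OF R, of k j i] db[OF R, of k i j] False by auto
      from lame_flatness[of i j "\<lambda>m j. pd i (b m j) R" "\<lambda>m j. b m j R" "\<lambda>m i. pd j (b m i) R",
          OF False this lame[OF R False]]
      show ?thesis
        unfolding pdA[OF R] unfolding A_def using dh[OF R] False by simp
    qed simp
  qed
  then obtain X where Xp: "X p = (mat 1, 0)" and Xs: "smooth_on V X"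
    and XD: "\<And>R. R \<in> V \<Longrightarrow> (X has_derivative (\<lambda>v. \<Sum>i\<in>UNIV. (v $ i) *\<^sub>R A i R (X R))) (at R)"
    by blast
  define \<phi> where "\<phi> i R = fst (X R) $ i" for i R
  define r where "r R = snd (X R)" for R
  have bl: "bounded_linear (\<lambda>x :: ((real^'n)^'n) \<times> (real^'n). fst x $ i)" for i
    using bounded_linear_compose[OF bounded_linear_vec_nth bounded_linear_fst] .
  have comp: "(\<phi> i has_derivative (\<lambda>v. fst (\<Sum>j\<in>UNIV. (v $ j) *\<^sub>R A j R (X R)) $ i)) (at R)"
    "(r has_derivative (\<lambda>v. snd (\<Sum>j\<in>UNIV. (v $ j) *\<^sub>R A j R (X R)))) (at R)" if "R \<in> V" for i R
    unfolding \<phi>_def r_def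
    using bounded_linear.has_derivative[OF bl XD[OF that]]
      bounded_linear.has_derivative[OF bounded_linear_snd XD[OF that]] by auto
  have ax: "(\<Sum>i\<in>UNIV. (axis j 1 $ i) *\<^sub>R F i) = F j" for j :: 'n and F :: "'n \<Rightarrow> ((real^'n)^'n) \<times> (real^'n)"
  proof -
    have "(\<Sum>i\<in>UNIV. (axis j 1 $ i) *\<^sub>R F i) = (\<Sum>i\<in>UNIV. if i = j then F j else 0)"
      by (rule sum.cong) (auto simp: axis_def)
    then show ?thesis by simp
  qed
  have pd\<phi>: "pd j (\<phi> i) R = fst (A j R (X R)) $ i" and pdr: "pd j r R = snd (A j R (X R))"
    if "R \<in> V" for i j R
    using pd_eqI[OF comp(1)[OF that]] pd_eqI[OF comp(2)[OF that]] by (simp_all only: ax)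
  have P1: "pd j (\<phi> i) R = b i j R *\<^sub>R \<phi> j R" if "R \<in> V" "j \<noteq> i" for R i j
    using that by (simp add: pd\<phi> A_def frame_field_components \<phi>_def)
  have P2: "pd i (\<phi> i) R = - (\<Sum>k\<in>UNIV - {i}. b k i R *\<^sub>R \<phi> k R)" if "R \<in> V" for R i
    using that by (simp add: pd\<phi> A_def frame_field_components \<phi>_def)
  have P3: "pd i r R = h i R *\<^sub>R \<phi> i R" if "R \<in> V" for R i
    using that by (simp add: pdr A_def frame_field_components \<phi>_def)
  have on: "orthonormal_frame (\<lambda>i. \<phi> i R)" if R: "R \<in> V" for R
  proof -
    have gram: "(\<Sum>i\<in>UNIV. \<phi> i R $ c * \<phi> i R $ d) = (if c = d then 1 else 0)" for c d
    proof -
      have skew: "(\<Sum>i\<in>UNIV. \<phi> i R $ c * pd j (\<phi> i) R $ d + pd j (\<phi> i) R $ c * \<phi> i R $ d) = 0"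
        if "R \<in> V" for R j
      proof -
        have "(\<Sum>i\<in>UNIV. \<phi> i R $ c * pd j (\<phi> i) R $ d + pd j (\<phi> i) R $ c * \<phi> i R $ d)
          = (\<phi> j R $ c * pd j (\<phi> j) R $ d + pd j (\<phi> j) R $ c * \<phi> j R $ d)
            + (\<Sum>i\<in>UNIV - {j}. \<phi> i R $ c * pd j (\<phi> i) R $ d + pd j (\<phi> i) R $ c * \<phi> i R $ d)"
          by (rule sum.remove) auto
        also have "(\<Sum>i\<in>UNIV - {j}. \<phi> i R $ c * pd j (\<phi> i) R $ d + pd j (\<phi> i) R $ c * \<phi> i R $ d)
          = (\<Sum>i\<in>UNIV - {j}. \<phi> j R $ c * (b i j R * \<phi> i R $ d) + b i j R * \<phi> i R $ c * \<phi> j R $ d)"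
          by (rule sum.cong) (auto simp: P1[OF that] algebra_simps)
        also have "\<dots> = \<phi> j R $ c * (\<Sum>i\<in>UNIV - {j}. b i j R * \<phi> i R $ d)
            + (\<Sum>i\<in>UNIV - {j}. b i j R * \<phi> i R $ c) * \<phi> j R $ d"
          by (simp only: sum.distrib sum_distrib_left sum_distrib_right)
        also have "(\<phi> j R $ c * pd j (\<phi> j) R $ d + pd j (\<phi> j) R $ c * \<phi> j R $ d) + \<dots> = 0"
          by (simp add: P2[OF that])
        finally show ?thesis .
      qed
      have "((\<lambda>R. \<Sum>i\<in>UNIV. \<phi> i R $ c * \<phi> i R $ d) has_derivative (\<lambda>v. 0)) (at R)" if "R \<in> V" for R
      proof -
        have D: "(\<phi> i has_derivative frechet_derivative (\<phi> i) (at R)) (at R)" for i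
          using comp(1)[OF that] frechet_derivative_works differentiable_def by blast
        have "((\<lambda>R. \<Sum>i\<in>UNIV. \<phi> i R $ c * \<phi> i R $ d) has_derivative (\<lambda>v. \<Sum>i\<in>UNIV.
            \<phi> i R $ c * frechet_derivative (\<phi> i) (at R) v $ d
            + frechet_derivative (\<phi> i) (at R) v $ c * \<phi> i R $ d)) (at R)"
          by (intro has_derivative_sum has_derivative_mult
              bounded_linear.has_derivative[OF bounded_linear_vec_nth D])
        moreover have "(\<Sum>i\<in>UNIV. \<phi> i R $ c * frechet_derivative (\<phi> i) (at R) v $ d
            + frechet_derivative (\<phi> i) (at R) v $ c * \<phi> i R $ d) = 0" for v
        proof -
          have fd: "frechet_derivative (\<phi> i) (at R) v = (\<Sum>j\<in>UNIV. (v $ j) *\<^sub>R pd j (\<phi> i) R)" for i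
            by (rule frechet_derivative_eq_sum_pd) (use D differentiable_def in blast)
          have "(\<Sum>i\<in>UNIV. \<phi> i R $ c * frechet_derivative (\<phi> i) (at R) v $ d
              + frechet_derivative (\<phi> i) (at R) v $ c * \<phi> i R $ d)
            = (\<Sum>i\<in>UNIV. \<Sum>j\<in>UNIV. v $ j *
                (\<phi> i R $ c * pd j (\<phi> i) R $ d + pd j (\<phi> i) R $ c * \<phi> i R $ d))"
            unfolding fd by (intro sum.cong refl)
              (simp add: sum_distrib_left sum_distrib_right sum.distrib[symmetric] algebra_simps)
          also have "\<dots> = (\<Sum>j\<in>UNIV. \<Sum>i\<in>UNIV. v $ j *
                (\<phi> i R $ c * pd j (\<phi> i) R $ d + pd j (\<phi> i) R $ c * \<phi> i R $ d))"
            by (rule sum.swap)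
          also have "\<dots> = 0"
            unfolding sum_distrib_left[symmetric] skew[OF that] by simp
          finally show ?thesis .
        qed
        ultimately show ?thesis by (simp only:)
      qed
      from has_derivative_zero_unique[OF V(2) has_derivative_at_withinI[OF this] R p]
      have "(\<Sum>i\<in>UNIV. \<phi> i R $ c * \<phi> i R $ d) = (\<Sum>i\<in>UNIV. \<phi> i p $ c * \<phi> i p $ d)" by simp
      also have "\<dots> = (\<Sum>i\<in>UNIV. if i = c then (if c = d then 1 else 0) else 0)"
        by (rule sum.cong) (auto simp: \<phi>_def Xp mat_def)
      finally show ?thesis by simp
    qed
    have "transpose (fst (X R)) ** fst (X R) = mat 1"
      using gram by (simp add: vec_eq_iff matrix_matrix_mult_def transpose_def mat_def \<phi>_def)
    then have "fst (X R) ** transpose (fst (X R)) = mat 1"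
      by (simp add: matrix_left_right_inverse)
    then have "\<forall>i j. (fst (X R) ** transpose (fst (X R))) $ i $ j = mat 1 $ i $ j" by simp
    then show ?thesis
      by (simp add: orthonormal_frame_def inner_vec_def matrix_matrix_mult_def transpose_def mat_def \<phi>_def)
  qed
  have s: "smooth_on V (\<phi> i)" "smooth_on V r" for i
    using Xs unfolding smooth_on_def \<phi>_def r_def
    by (blast intro: Ck_on_linear[OF V(1) bl] Ck_on_linear[OF V(1) bounded_linear_snd])+
  show ?thesis
    by (rule exI[of _ \<phi>], rule exI[of _ r]) (simp add: s on P1 P2 P3)
qed

section \<open>Hypersurfaces of an orthogonal coordinate system\<close>

lemma frame_differential:
  fixes \<phi> :: "'n::finite \<Rightarrow> real^'n"
  assumes "orthonormal_frame \<phi>" "\<And>i. h i \<noteq> 0"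
  defines "D \<equiv> \<lambda>v. \<Sum>i\<in>UNIV. (v $ i) *\<^sub>R (h i *\<^sub>R \<phi> i)"
  shows "\<phi> i \<bullet> D v = h i * v $ i" and "bij D"
proof -
  have ip: "\<phi> i \<bullet> D v = h i * v $ i" for i v
  proof -
    have "\<phi> i \<bullet> D v = (\<Sum>k\<in>UNIV. if k = i then h i * v $ i else 0)"
      unfolding D_def inner_sum_right
      by (rule sum.cong) (use assms(1) in \<open>auto simp: orthonormal_frame_def\<close>)
    then show ?thesis by simp
  qed
  then show "\<phi> i \<bullet> D v = h i * v $ i" .
  have "linear D"
    by (rule linearI) (simp_all add: D_def distrib_right scaleR_left_distrib sum.distrib scaleR_sum_right mult.assoc)
  moreover have "inj D"
  proof (rule injI)
    fix v w assume "D v = D w"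
    then have "h i * v $ i = h i * w $ i" for i using ip by metis
    then show "v = w" using assms(2) by (simp add: vec_eq_iff)
  qed
  ultimately show "bij D"
    by (simp add: bij_def linear_injective_imp_surjective)
qed

text \<open>Local injectivity is the first half of the inverse function theorem; it asks for continuity of the
  differential in the operator norm, obtained here from the continuity of the finitely many partial
  derivatives.\<close>
lemma regular_map_coordinate_system:
  fixes r :: "real^'n::finite \<Rightarrow> real^'n"
  assumes V: "open V" and r: "smooth_on V r"
    and bij: "\<And>x. x \<in> V \<Longrightarrow> bij (frechet_derivative r (at x))"
  shows "coordinate_system_on V r"
  unfolding coordinate_system_on_def
proof (intro conjI r ballI bij)
  fix x assume x: "x \<in> V"
  have C: "Ck_on (Suc 0) V r" using r by (simp only: smooth_on_def)
  let ?D = "\<lambda>x. frechet_derivative r (at x)"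
  have D: "(r has_derivative ?D x) (at x)" if "x \<in> V" for x
    using Ck_on_has_derivative[OF C that] .
  obtain g where g: "linear g" "g \<circ> ?D x = id"
    using linear_injective_left_inverse[OF has_derivative_linear[OF D[OF x]] bij_is_inj[OF bij[OF x]]]
    by blast
  have cont: "\<exists>d>0. \<forall>y. dist x y < d \<longrightarrow> onorm (\<lambda>v. ?D y v - ?D x v) < e" if e: "e > 0" for e
  proof -
    define N where "N = real CARD('n)"
    have N: "N > 0" by (simp add: N_def)
    have "\<exists>d>0. \<forall>y. dist x y < d \<longrightarrow> norm (?D y (axis i 1) - ?D x (axis i 1)) < e / (2 * N)" for i
    proof -
      have "continuous_on V (\<lambda>y. ?D y (axis i 1))" using C by simp
      then have "isCont (\<lambda>y. ?D y (axis i 1)) x"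
        using V x by (simp add: continuous_on_eq_continuous_at)
      then show ?thesis
        using e N unfolding continuous_at_eps_delta
        by (auto simp: dist_norm norm_minus_commute dest: spec[of _ "e / (2 * N)"])
    qed
    then obtain d where d: "\<And>i. d i > 0"
      "\<And>i y. dist x y < d i \<Longrightarrow> norm (?D y (axis i 1) - ?D x (axis i 1)) < e / (2 * N)"
      by metis
    obtain d0 where d0: "d0 > 0" "ball x d0 \<subseteq> V" using V x open_contains_ball by blast
    define d1 where "d1 = Min (insert d0 (range d))"
    have d1: "d1 > 0" "d1 \<le> d0" "\<And>i. d1 \<le> d i"
      unfolding d1_def using d(1) d0(1) by (auto intro!: Min_le simp del: Min_insert)
    show ?thesis
    proof (intro exI[of _ d1] conjI d1(1) allI impI)
      fix y assume y: "dist x y < d1"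
      then have yV: "y \<in> V" using d0(2) d1(2) by auto
      \<comment> \<open>The factor 2 turns the non-strict bound on the operator norm into a strict one.\<close>
      have "norm (?D y v - ?D x v) \<le> (\<Sum>i\<in>(UNIV :: 'n set). e / (2 * N)) * norm v" for v
      proof (rule norm_directional_le)
        show "linear (\<lambda>v. ?D y v - ?D x v)"
          by (intro linear_compose_sub has_derivative_linear[OF D] x yV)
        show "norm (?D y (axis i 1) - ?D x (axis i 1)) \<le> e / (2 * N)" for i
          using d(2)[of y i] y d1(3)[of i] by linarith
      qed
      then have "norm (?D y v - ?D x v) \<le> e / 2 * norm v" for v
        using N by (simp add: N_def)
      then have "onorm (\<lambda>v. ?D y v - ?D x v) \<le> e / 2" by (rule onorm_le)
      then show "onorm (\<lambda>v. ?D y v - ?D x v) < e" using e by simp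
    qed
  qed
  obtain \<rho> where "\<rho> > 0" "ball x \<rho> \<subseteq> V" "inj_on r (ball x \<rho>)"
    using has_derivative_locally_injective[OF x V linear_linear[THEN iffD2, OF g(1)] g(2) D cont] by blast
  then show "\<exists>N. open N \<and> x \<in> N \<and> N \<subseteq> V \<and> inj_on r N"
    by (intro exI[of _ "ball x \<rho>"]) auto
qed

definition diagonal_operator :: "('n::finite \<Rightarrow> real^'n) \<Rightarrow> ('n \<Rightarrow> real) \<Rightarrow> 'n \<Rightarrow> real^'n \<Rightarrow> real^'n" where
  "diagonal_operator \<phi> \<kappa> m u = (\<Sum>i\<in>UNIV - {m}. (\<kappa> i * (u \<bullet> \<phi> i)) *\<^sub>R \<phi> i)"

text \<open>In a frame adapted to the coordinates everything is diagonal: the hypothesis on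
  \<open>\<partial>\<^sub>i \<phi>\<^sub>m\<close> is Rodrigues' formula, so the Weingarten operator
  multiplies the \<open>i\<close>-th coordinate vector by \<open>\<kappa>\<^sub>m\<^sub>i\<close>.
  The last part is what makes operators of different hypersurfaces comparable: in coordinates the
  lengths \<open>h\<^sub>i\<close> and the frame drop out.\<close>
theorem orthogonal_frame_geometry:
  fixes r :: "real^'n::finite \<Rightarrow> real^'n" and \<phi> :: "'n \<Rightarrow> real^'n \<Rightarrow> real^'n"
  assumes V: "open V" and s\<phi>: "\<And>i. smooth_on V (\<phi> i)" and sr: "smooth_on V r"
    and on: "\<And>R. R \<in> V \<Longrightarrow> orthonormal_frame (\<lambda>i. \<phi> i R)"
    and dr: "\<And>R i. R \<in> V \<Longrightarrow> pd i r R = h i R *\<^sub>R \<phi> i R"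
    and h: "\<And>R i. R \<in> V \<Longrightarrow> h i R > 0"
    and d\<phi>: "\<And>R i m. R \<in> V \<Longrightarrow> i \<noteq> m \<Longrightarrow> pd i (\<phi> m) R = \<kappa> m i R *\<^sub>R pd i r R"
  shows "orthogonal_coordinate_system_on V r"
    and "\<And>R i j. R \<in> V \<Longrightarrow> metric_of r R i j = (if i = j then (h i R)\<^sup>2 else 0)"
    and "unit_normal_on V r m (\<phi> m)"
    and "\<And>R. R \<in> V \<Longrightarrow>
      weingarten_operator r (\<phi> m) m R (diagonal_operator (\<lambda>i. \<phi> i R) (\<lambda>i. \<kappa> m i R) m)"
    and "\<And>R. R \<in> V \<Longrightarrow> curvature_line_coordinates_at r m R
      (diagonal_operator (\<lambda>i. \<phi> i R) (\<lambda>i. \<kappa> m i R) m) (\<lambda>i. \<kappa> m i R)"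
    and "\<And>R v. R \<in> V \<Longrightarrow>
      in_coordinates r R (diagonal_operator (\<lambda>i. \<phi> i R) (\<lambda>i. \<kappa> m i R) m) v
        = (\<chi> i. if i = m then 0 else \<kappa> m i R * v $ i)"
proof -
  let ?W = "\<lambda>R. diagonal_operator (\<lambda>i. \<phi> i R) (\<lambda>i. \<kappa> m i R) m"
  let ?Dr = "\<lambda>R. frechet_derivative r (at R)"
  have ip: "\<phi> i R \<bullet> \<phi> j R = (if i = j then 1 else 0)" if "R \<in> V" for i j R
    using on[OF that] by (simp add: orthonormal_frame_def)
  have diff: "r differentiable (at R)" "\<phi> i differentiable (at R)" if "R \<in> V" for i R
  proof -
    have "Ck_on (Suc 0) V r" "Ck_on (Suc 0) V (\<phi> i)" using sr s\<phi>[of i] by (simp_all only: smooth_on_def)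
    with that show "r differentiable (at R)" "\<phi> i differentiable (at R)" by simp_all
  qed
  have Dr: "?Dr R = (\<lambda>v. \<Sum>i\<in>UNIV. (v $ i) *\<^sub>R (h i R *\<^sub>R \<phi> i R))" if "R \<in> V" for R
    using frechet_derivative_eq_sum_pd[OF diff(1)[OF that]] dr[OF that] by (simp add: fun_eq_iff)
  have h0: "h i R \<noteq> 0" if "R \<in> V" for i R using h[OF that, of i] by simp
  have \<phi>Dr: "\<phi> i R \<bullet> ?Dr R v = h i R * v $ i" and bijDr: "bij (?Dr R)" if "R \<in> V" for i R v
    using frame_differential[OF on[OF that], of "\<lambda>i. h i R"] h0[OF that] Dr[OF that] by auto
  have cs: "coordinate_system_on V r"
    by (rule regular_map_coordinate_system[OF V sr bijDr])
  show met: "metric_of r R i j = (if i = j then (h i R)\<^sup>2 else 0)" if "R \<in> V" for R i j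
    by (simp add: metric_of_def dr[OF that] ip[OF that] power2_eq_square)
  show "orthogonal_coordinate_system_on V r"
    unfolding orthogonal_coordinate_system_on_def using cs met by (auto simp: metric_of_def)
  show "unit_normal_on V r m (\<phi> m)"
    unfolding unit_normal_on_def hypersurface_tangent_def
    by (auto simp: \<phi>Dr ip norm_eq_1)
  have WDr: "?W R (?Dr R v) = ?Dr R (\<chi> i. if i = m then 0 else \<kappa> m i R * v $ i)" if R: "R \<in> V" for R v
  proof -
    have "?W R (?Dr R v) = (\<Sum>i\<in>UNIV - {m}. (\<kappa> m i R * (h i R * v $ i)) *\<^sub>R \<phi> i R)"
      unfolding diagonal_operator_def using \<phi>Dr[OF R] by (simp add: inner_commute)
    also have "\<dots> = (\<Sum>i\<in>UNIV - {m}. ((\<chi> i. if i = m then 0 else \<kappa> m i R * v $ i) $ i) *\<^sub>R (h i R *\<^sub>R \<phi> i R))"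
      by (rule sum.cong) (auto simp: mult_ac)
    also have "\<dots> = ?Dr R (\<chi> i. if i = m then 0 else \<kappa> m i R * v $ i)"
      unfolding Dr[OF R] by (rule sum.mono_neutral_left) auto
    finally show ?thesis .
  qed
  show "in_coordinates r R (?W R) v = (\<chi> i. if i = m then 0 else \<kappa> m i R * v $ i)" if R: "R \<in> V" for R v
    by (simp add: in_coordinates_def WDr[OF R] inv_f_f[OF bij_is_inj[OF bijDr[OF R]]])
  show "weingarten_operator r (\<phi> m) m R (?W R)" if R: "R \<in> V" for R
    unfolding weingarten_operator_def
  proof (intro conjI allI impI)
    show "linear (?W R)"
      by (rule linearI) (simp_all add: diagonal_operator_def inner_left_distrib distrib_left
          scaleR_left_distrib sum.distrib scaleR_sum_right mult_ac)
    show "?W R (\<phi> m R) = 0"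
      unfolding diagonal_operator_def by (rule sum.neutral) (simp add: ip[OF R])
    show "?W R ` hypersurface_tangent r m R \<subseteq> hypersurface_tangent r m R"
      unfolding hypersurface_tangent_def using WDr[OF R] by auto
    fix v :: "real^'n" assume v: "v $ m = 0"
    have "frechet_derivative (\<phi> m) (at R) v = (\<Sum>i\<in>UNIV. (v $ i) *\<^sub>R pd i (\<phi> m) R)"
      by (rule frechet_derivative_eq_sum_pd[OF diff(2)[OF R]])
    \<comment> \<open>Nothing is known about \<open>\<partial>\<^sub>m \<phi>\<^sub>m\<close> here, but its coefficient \<open>v\<^sub>m\<close> vanishes.\<close>
    also have "\<dots> = (\<Sum>i\<in>UNIV. ((\<chi> i. if i = m then 0 else \<kappa> m i R * v $ i) $ i) *\<^sub>R (h i R *\<^sub>R \<phi> i R))"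
      by (rule sum.cong) (auto simp: v d\<phi>[OF R] dr[OF R])
    also have "\<dots> = ?W R (?Dr R v)" unfolding WDr[OF R] unfolding Dr[OF R] ..
    finally show "frechet_derivative (\<phi> m) (at R) v = ?W R (?Dr R v)" .
  qed
  show "curvature_line_coordinates_at r m R (?W R) (\<lambda>i. \<kappa> m i R)" if R: "R \<in> V" for R
    unfolding curvature_line_coordinates_at_def
  proof (intro conjI allI impI)
    fix i assume i: "i \<noteq> m"
    show "pd i r R \<noteq> 0" using h0[OF R, of i] ip[OF R, of i i] by (auto simp: dr[OF R])
    have "?W R (pd i r R) = (\<Sum>k\<in>UNIV - {m}. if k = i then (\<kappa> m i R * h i R) *\<^sub>R \<phi> i R else 0)"
      unfolding diagonal_operator_def dr[OF R] by (rule sum.cong) (auto simp: ip[OF R])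
    then show "?W R (pd i r R) = \<kappa> m i R *\<^sub>R pd i r R" using i by (simp add: dr[OF R])
  qed (simp add: dr[OF R] ip[OF R])
qed

section \<open>The pencil of metrics\<close>

text \<open>Here \<open>e\<^sub>i = \<lambda> + \<eta>\<^sub>i\<close>, so that \<open>e\<^sub>j - e\<^sub>i =
  \<eta>\<^sub>j - \<eta>\<^sub>i\<close> for all \<open>\<lambda>\<close>, and the hypotheses are
  the equations for \<open>\<partial>\<^sub>i \<beta>\<^sub>i\<^sub>j\<close> and
  \<open>\<partial>\<^sub>j \<beta>\<^sub>j\<^sub>i\<close>. They are the solution, for these two
  derivatives, of a pair of linear equations, one being the coefficient of \<open>\<lambda>\<close>
  in the conclusion; the conclusion is therefore an identity after multiplication by
  \<open>e\<^sub>j - e\<^sub>i\<close>.\<close>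
lemma lame_of_pencil:
  fixes e s De :: "'n::finite \<Rightarrow> real"
  assumes "i \<noteq> j" "e i \<noteq> e j" "\<And>k. e k > 0"
    and "Bij = 1/2 * (De i / (e j - e i)) * b i j + 1/2 * (De j / (e j - e i)) * b j i
      + (\<Sum>k\<in>UNIV - {i, j}. (e k - e j) / (e j - e i) * b k i * b k j)"
    and "Bji = 1/2 * (De j / (e i - e j)) * b j i + 1/2 * (De i / (e i - e j)) * b i j
      + (\<Sum>k\<in>UNIV - {j, i}. (e k - e i) / (e i - e j) * b k j * b k i)"
  shows "De i / 2 * b i j + De j / 2 * b j i + e i * Bij + e j * Bji
    + (\<Sum>k\<in>UNIV - {i, j}. e k * (b k i * b k j)) = (0::real)"
proof -
  define T where "T = (\<Sum>k\<in>UNIV - {i, j}. b k i * b k j)"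
  define Te where "Te = (\<Sum>k\<in>UNIV - {i, j}. e k * (b k i * b k j))"
  define a where "a = De i / 2 * b i j + De j / 2 * b j i"
  have ne: "e j - e i \<noteq> 0" using assms(2) by simp
  have "(\<Sum>k\<in>UNIV - {i, j}. (e k - e j) / (e j - e i) * b k i * b k j) = (Te - e j * T) / (e j - e i)"
    unfolding T_def Te_def sum_distrib_left sum_subtractf[symmetric] sum_divide_distrib
    by (rule sum.cong) (simp_all add: field_simps)
  then have "Bij = (a + (Te - e j * T)) / (e j - e i)"
    unfolding assms(4) a_def by (simp add: add_divide_distrib)
  then have 1: "Bij * (e j - e i) = a + (Te - e j * T)"
    using ne by simp
  have "(\<Sum>k\<in>UNIV - {j, i}. (e k - e i) / (e i - e j) * b k j * b k i) = (Te - e i * T) / (e i - e j)"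
    unfolding T_def Te_def sum_distrib_left sum_subtractf[symmetric] sum_divide_distrib
    by (rule sum.cong) (auto simp: field_simps)
  then have "Bji = (a + (Te - e i * T)) / (e i - e j)"
    unfolding assms(5) a_def by (simp add: add_divide_distrib)
  then have "Bji * (e i - e j) = a + (Te - e i * T)"
    using ne by simp
  then have 2: "Bji * (e j - e i) = - (a + (Te - e i * T))"
    by (simp add: algebra_simps)
  have "(a + e i * Bij + e j * Bji + Te) * (e j - e i)
      = a * (e j - e i) + e i * (Bij * (e j - e i)) + e j * (Bji * (e j - e i)) + Te * (e j - e i)"
    by (simp add: algebra_simps)
  also have "\<dots> = 0" unfolding 1 2 by (simp add: algebra_simps)
  finally show ?thesis using ne by (simp add: a_def Te_def)
qed

text \<open>With \<open>s\<^sub>i = sqrt (\<lambda> + \<eta>\<^sub>i)\<close>, which depends on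
  \<open>R\<^sub>i\<close> alone, the functions \<open>b\<^sub>i\<^sub>j = s\<^sub>i
  \<beta>\<^sub>i\<^sub>j / s\<^sub>j\<close> and \<open>h\<^sub>i = H\<^sub>i / s\<^sub>i\<close>
  solve the Lame equations. The equations for distinct indices are inherited from
  \<open>\<beta>\<close> and \<open>H\<close>, because the factors involved are constant in the
  direction of differentiation; the remaining one, multiplied by \<open>s\<^sub>i s\<^sub>j\<close>,
  is \<open>lame_of_pencil\<close>.\<close>
theorem pencil_frame:
  fixes V :: "(real^'n::finite) set"
    and \<eta> :: "'n \<Rightarrow> real \<Rightarrow> real" and H :: "'n \<Rightarrow> real^'n \<Rightarrow> real"
    and \<beta> :: "'n \<Rightarrow> 'n \<Rightarrow> real^'n \<Rightarrow> real"
  assumes V: "open V" "convex V"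
    and s\<eta>: "\<And>i. smooth_on ((\<lambda>R. R $ i) ` V) (\<eta> i)"
    and sH: "\<And>i. smooth_on V (H i)"
    and s\<beta>: "\<And>i j. i \<noteq> j \<Longrightarrow> smooth_on V (\<beta> i j)"
    and ne: "\<And>R i j. R \<in> V \<Longrightarrow> i \<noteq> j \<Longrightarrow> \<eta> i (R $ i) \<noteq> \<eta> j (R $ j)"
    and dH: "\<And>R i j. R \<in> V \<Longrightarrow> i \<noteq> j \<Longrightarrow> pd i (H j) R = \<beta> i j R * H i R"
    and d\<beta>: "\<And>R i j k. R \<in> V \<Longrightarrow> i \<noteq> j \<Longrightarrow> i \<noteq> k \<Longrightarrow> j \<noteq> k \<Longrightarrow>
           pd k (\<beta> i j) R = \<beta> i k R * \<beta> k j R"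
    and d\<beta>': "\<And>R i j. R \<in> V \<Longrightarrow> i \<noteq> j \<Longrightarrow>
           pd i (\<beta> i j) R =
             1/2 * (deriv (\<eta> i) (R $ i) / (\<eta> j (R $ j) - \<eta> i (R $ i))) * \<beta> i j R
           + 1/2 * (deriv (\<eta> j) (R $ j) / (\<eta> j (R $ j) - \<eta> i (R $ i))) * \<beta> j i R
           + (\<Sum>k\<in>UNIV - {i, j}.
                (\<eta> k (R $ k) - \<eta> j (R $ j)) / (\<eta> j (R $ j) - \<eta> i (R $ i)) * \<beta> k i R * \<beta> k j R)"
    and adm: "admissible_on V \<eta> l"
  shows "\<exists>(\<phi> :: 'n \<Rightarrow> real^'n \<Rightarrow> real^'n) (r :: real^'n \<Rightarrow> real^'n).
    (\<forall>i. smooth_on V (\<phi> i)) \<and> smooth_on V r \<and>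
    (\<forall>R\<in>V. orthonormal_frame (\<lambda>i. \<phi> i R)) \<and>
    (\<forall>R\<in>V. \<forall>i j. j \<noteq> i \<longrightarrow> pd j (\<phi> i) R =
      (sqrt ((l + \<eta> i (R $ i)) / (l + \<eta> j (R $ j))) * \<beta> i j R) *\<^sub>R \<phi> j R) \<and>
    (\<forall>R\<in>V. \<forall>i. pd i (\<phi> i) R = - (\<Sum>k\<in>UNIV - {i}.
      (sqrt ((l + \<eta> k (R $ k)) / (l + \<eta> i (R $ i))) * \<beta> k i R) *\<^sub>R \<phi> k R)) \<and>
    (\<forall>R\<in>V. \<forall>i. pd i r R = (H i R / sqrt (l + \<eta> i (R $ i))) *\<^sub>R \<phi> i R)"
proof -
  define e where "e i R = l + \<eta> i (R $ i)" for i and R :: "real^'n"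
  define s where "s i R = sqrt (e i R)" for i R
  define b where "b i j R = s i R * (inverse (s j R) * \<beta> i j R)" for i j R
  define h where "h i R = H i R * inverse (s i R)" for i R
  have epos: "e i R > 0" if "R \<in> V" for i R
    using adm that by (simp add: admissible_on_def e_def)
  have spos: "s i R > 0" and s2: "s i R * s i R = e i R" if "R \<in> V" for i R
    using epos[OF that, of i] by (simp_all add: s_def)
  have Ce: "Ck_on k V (e i)" for k i
    unfolding e_def using s\<eta>[of i]
    by (intro Ck_on_add[OF V(1)] Ck_on_const[OF V(1)]
        Ck_on_compose_linear[OF V(1) bounded_linear_vec_nth subset_refl]) (simp add: smooth_on_def)
  have Cs: "Ck_on k V (s i)" for k i
    unfolding s_def by (rule Ck_on_sqrt[OF V(1) epos Ce])
  have Cis: "Ck_on k V (\<lambda>R. inverse (s i R))" for k i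
    by (rule Ck_on_inverse[OF V(1) _ Cs]) (use spos in \<open>simp add: less_imp_neq[THEN not_sym]\<close>)
  have C\<beta>: "Ck_on k V (\<beta> i j)" if "i \<noteq> j" for k i j using s\<beta>[OF that] by (simp add: smooth_on_def)
  have CH: "Ck_on k V (H i)" for k i using sH by (simp add: smooth_on_def)
  have Dis\<beta>: "Ck_on k V (\<lambda>R. inverse (s m R) * \<beta> i j R)" if "i \<noteq> j" for k i j m
    by (intro Ck_on_mult[OF V(1)] Cis C\<beta> that)
  note D = Ck_on_has_derivative[where k = 0]
  have De: "(e i has_derivative (\<lambda>v. deriv (\<eta> i) (R $ i) * (v $ i))) (at R)" if R: "R \<in> V" for i R
  proof -
    have "Ck_on (Suc 0) ((\<lambda>R. R $ i) ` V) (\<eta> i)" using s\<eta>[of i] by (simp only: smooth_on_def)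
    then have "\<eta> i differentiable (at (R $ i))" using R by simp
    then have "(\<eta> i has_derivative (\<lambda>t. deriv (\<eta> i) (R $ i) * t)) (at (R $ i))"
      using DERIV_deriv_iff_real_differentiable has_field_derivative_def by metis
    from has_derivative_compose[OF bounded_linear_imp_has_derivative[OF bounded_linear_vec_nth] this]
    show ?thesis unfolding e_def by (intro derivative_eq_intros) auto
  qed
  have Ds: "(s i has_derivative (\<lambda>v. deriv (\<eta> i) (R $ i) / (2 * s i R) * (v $ i))) (at R)"
    if R: "R \<in> V" for i R
    using has_derivative_real_sqrt[OF epos[OF R] De[OF R], of i] unfolding s_def
    by (rule has_derivative_eq_rhs) (simp add: fun_eq_iff field_simps)
  have pds: "pd k (s i) R = (if k = i then deriv (\<eta> i) (R $ i) / (2 * s i R) else 0)"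
    if "R \<in> V" for k i R
    using pd_eqI[OF Ds[OF that]] by (simp add: axis_def)
  \<comment> \<open>Only derivatives in the other directions occur, because \<open>b\<^sub>i\<^sub>j\<close> and \<open>h\<^sub>j\<close> are never differentiated in the direction \<open>j\<close>.\<close>
  have pdis: "pd k (\<lambda>R. inverse (s i R)) R = 0" if "R \<in> V" "k \<noteq> i" for k i R
  proof -
    have "s i R \<noteq> 0" using spos[OF that(1), of i] by simp
    from pd_eqI[OF Deriv.has_derivative_inverse[OF this Ds[OF that(1)]]]
    show ?thesis using that(2) by (simp add: axis_def)
  qed
  have pdb: "pd k (b i j) R = pd k (s i) R * (inverse (s j R) * \<beta> i j R)
      + s i R * (inverse (s j R) * pd k (\<beta> i j) R)" if "R \<in> V" "i \<noteq> j" "k \<noteq> j" for i j k R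
    unfolding b_def using pd_mult[OF D[OF Cs that(1)] D[OF Dis\<beta>[OF that(2)] that(1)]]
      pd_mult[OF D[OF Cis that(1)] D[OF C\<beta>[OF that(2)] that(1)]] pdis[OF that(1,3)]
    by simp
  have beq: "sqrt ((l + \<eta> i (R $ i)) / (l + \<eta> j (R $ j))) * \<beta> i j R = b i j R" for i j R
    unfolding b_def s_def e_def real_sqrt_divide by (simp add: divide_inverse)
  have heq: "H i R / sqrt (l + \<eta> i (R $ i)) = h i R" for i R
    by (simp add: h_def s_def e_def divide_inverse)
  show ?thesis
    unfolding beq heq
  proof (rule lame_system_solution[OF V])
    show "smooth_on V (b i j)" if "i \<noteq> j" for i j
      unfolding b_def smooth_on_def by (intro allI Ck_on_mult[OF V(1)] Cs Cis C\<beta> that)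
    show "smooth_on V (h i)" for i
      unfolding h_def smooth_on_def by (intro allI Ck_on_mult[OF V(1)] Cis CH)
    show "pd i (h j) R = b i j R * h i R" if R: "R \<in> V" and ij: "i \<noteq> j" for R i j
      unfolding h_def pd_mult[OF D[OF CH R] D[OF Cis R]] b_def
      using spos[OF R, of i] by (simp add: pdis[OF R ij] dH[OF R ij])
    show "pd k (b i j) R = b i k R * b k j R"
      if R: "R \<in> V" and ijk: "i \<noteq> j" "i \<noteq> k" "j \<noteq> k" for R i j k
      unfolding pdb[OF R ijk(1) ijk(3)[symmetric]] using ijk spos[OF R, of k]
      by (simp add: pds[OF R] d\<beta>[OF R] b_def)
    show "pd i (b i j) R + pd j (b j i) R + (\<Sum>k\<in>UNIV - {i, j}. b k i R * b k j R) = 0"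
      if R: "R \<in> V" and ij: "i \<noteq> j" for R i j
    proof -
      have si: "s i R \<noteq> 0" "s j R \<noteq> 0" using spos[OF R, of i] spos[OF R, of j] by auto
      let ?d = "\<lambda>i. deriv (\<eta> i) (R $ i)"
      have "(\<Sum>k\<in>UNIV - {i, j}. b k i R * b k j R)
          = (\<Sum>k\<in>UNIV - {i, j}. e k R * (\<beta> k i R * \<beta> k j R)) / (s i R * s j R)"
        unfolding sum_divide_distrib s2[OF R, symmetric]
        by (rule sum.cong) (simp_all add: b_def divide_inverse)
      moreover have "pd i (b i j) R = (?d i / 2 * \<beta> i j R + e i R * pd i (\<beta> i j) R) / (s i R * s j R)"
        unfolding pdb[OF R ij ij] s2[OF R, symmetric] using si by (simp add: pds[OF R] field_simps)
      moreover have "pd j (b j i) R = (?d j / 2 * \<beta> j i R + e j R * pd j (\<beta> j i) R) / (s i R * s j R)"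
        unfolding pdb[OF R ij[symmetric] ij[symmetric]] s2[OF R, symmetric] using si
        by (simp add: pds[OF R] field_simps)
      moreover have "?d i / 2 * \<beta> i j R + ?d j / 2 * \<beta> j i R
          + e i R * pd i (\<beta> i j) R + e j R * pd j (\<beta> j i) R
          + (\<Sum>k\<in>UNIV - {i, j}. e k R * (\<beta> k i R * \<beta> k j R)) = 0"
        by (rule lame_of_pencil[of i j "\<lambda>i. e i R" _ "?d" "\<lambda>i j. \<beta> i j R"])
          (use d\<beta>'[OF R ij] d\<beta>'[OF R ij[symmetric]] ij ne[OF R ij] epos[OF R] in \<open>simp_all add: e_def\<close>)
      ultimately show ?thesis
        by (simp add: add_divide_distrib[symmetric] algebra_simps)
    qed
  qed
qed

lemma conditional_choice2:
  "(\<And>x. A x \<Longrightarrow> \<exists>y z. Q x y z) \<Longrightarrow> \<exists>f g. \<forall>x. A x \<longrightarrow> Q x (f x) (g x)"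
  by metis

text \<open>One ball \<open>V\<close> serves all admissible \<open>l\<close>, because the integration is global on convex sets; shrinking \<open>V\<close> with \<open>l\<close> would not do, as \<open>l + \<eta>\<^sub>i\<close> may tend to zero at the boundary of \<open>V\<close>.\<close>
theorem mainTheorem3:
  fixes U :: "(real^'n::finite) set"
    and \<eta> :: "'n \<Rightarrow> real \<Rightarrow> real"
    and H :: "'n \<Rightarrow> real^'n \<Rightarrow> real"
    and \<beta> :: "'n \<Rightarrow> 'n \<Rightarrow> real^'n \<Rightarrow> real"
  assumes "open U"
    and "\<And>i. smooth_on ((\<lambda>R. R $ i) ` U) (\<eta> i)"
    and "\<And>i. smooth_on U (H i)"
    and "\<And>i j. i \<noteq> j \<Longrightarrow> smooth_on U (\<beta> i j)"
    and "\<And>R i j. R \<in> U \<Longrightarrow> i \<noteq> j \<Longrightarrow> \<eta> i (R $ i) \<noteq> \<eta> j (R $ j)"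
    and "\<And>R i. R \<in> U \<Longrightarrow> H i R > 0"
    and "\<And>R i j. R \<in> U \<Longrightarrow> i \<noteq> j \<Longrightarrow> pd i (H j) R = \<beta> i j R * H i R"
    and "\<And>R i j k. R \<in> U \<Longrightarrow> i \<noteq> j \<Longrightarrow> i \<noteq> k \<Longrightarrow> j \<noteq> k \<Longrightarrow>
           pd k (\<beta> i j) R = \<beta> i k R * \<beta> k j R"
    and "\<And>R i j. R \<in> U \<Longrightarrow> i \<noteq> j \<Longrightarrow>
           pd i (\<beta> i j) R =
             1/2 * (deriv (\<eta> i) (R $ i) / (\<eta> j (R $ j) - \<eta> i (R $ i))) * \<beta> i j R
           + 1/2 * (deriv (\<eta> j) (R $ j) / (\<eta> j (R $ j) - \<eta> i (R $ i))) * \<beta> j i R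
           + (\<Sum>k\<in>UNIV - {i, j}.
                (\<eta> k (R $ k) - \<eta> j (R $ j)) / (\<eta> j (R $ j) - \<eta> i (R $ i)) * \<beta> k i R * \<beta> k j R)"
  shows
    "\<forall>p\<in>U. \<forall>l\<^sub>0. (\<forall>i. l\<^sub>0 + \<eta> i (p $ i) > 0) \<longrightarrow>
      (\<exists>V. open V \<and> p \<in> V \<and> V \<subseteq> U \<and> admissible_on V \<eta> l\<^sub>0 \<and>
        (\<exists>(\<phi> :: real \<Rightarrow> 'n \<Rightarrow> real^'n \<Rightarrow> real^'n)
          (r :: real \<Rightarrow> real^'n \<Rightarrow> real^'n)
          (W :: real \<Rightarrow> 'n \<Rightarrow> real^'n \<Rightarrow> (real^'n \<Rightarrow> real^'n)).
          (\<forall>l. admissible_on V \<eta> l \<longrightarrow>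
             (\<forall>i. smooth_on V (\<phi> l i)) \<and>
             (\<forall>R\<in>V. orthonormal_frame (\<lambda>i. \<phi> l i R)) \<and>
             (\<forall>R\<in>V. \<forall>i j. j \<noteq> i \<longrightarrow>
                pd j (\<phi> l i) R =
                  (sqrt ((l + \<eta> i (R $ i)) / (l + \<eta> j (R $ j))) * \<beta> i j R) *\<^sub>R \<phi> l j R) \<and>
             (\<forall>R\<in>V. \<forall>i.
                pd i (\<phi> l i) R =
                  - (\<Sum>k\<in>UNIV - {i}.
                      (sqrt ((l + \<eta> k (R $ k)) / (l + \<eta> i (R $ i))) * \<beta> k i R) *\<^sub>R \<phi> l k R)) \<and>
             (\<forall>R\<in>V. \<forall>i.
                pd i (r l) R = (H i R / sqrt (l + \<eta> i (R $ i))) *\<^sub>R \<phi> l i R) \<and>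
             orthogonal_coordinate_system_on V (r l) \<and>
             (\<forall>R\<in>V. \<forall>i j.
                metric_of (r l) R i j = (if i = j then (H i R)\<^sup>2 / (l + \<eta> i (R $ i)) else 0)) \<and>
             flat_metric_on V (\<lambda>R i j. if i = j then (H i R)\<^sup>2 / (l + \<eta> i (R $ i)) else 0) \<and>
             (\<forall>m. unit_normal_on V (r l) m (\<phi> l m)) \<and>
             (\<forall>R\<in>V. \<forall>m.
                (\<forall>i. i \<noteq> m \<longrightarrow>
                   pd i (\<phi> l m) R =
                     (\<beta> m i R / H i R * sqrt (l + \<eta> m (R $ m))) *\<^sub>R pd i (r l) R) \<and>
                weingarten_operator (r l) (\<phi> l m) m R (W l m R) \<and>
                curvature_line_coordinates_at (r l) m R (W l m R)
                  (\<lambda>i. \<beta> m i R / H i R * sqrt (l + \<eta> m (R $ m))))) \<and>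
          (\<forall>l l' m c. admissible_on V \<eta> l \<longrightarrow> admissible_on V \<eta> l' \<longrightarrow>
             (\<exists>s>0. \<forall>R\<in>V. R $ m = c \<longrightarrow>
                (\<forall>v. v $ m = 0 \<longrightarrow>
                   in_coordinates (r l') R (W l' m R) v =
                     s *\<^sub>R in_coordinates (r l) R (W l m R) v)))))"
proof (intro ballI allI impI)
  fix p l\<^sub>0 assume p: "p \<in> U" and l0: "\<forall>i. l\<^sub>0 + \<eta> i (p $ i) > 0"
  have "\<exists>d>0. \<forall>R\<in>U. dist R p < d \<longrightarrow> l\<^sub>0 + \<eta> i (R $ i) > 0" for i
  proof -
    have "Ck_on 0 ((\<lambda>R. R $ i) ` U) (\<eta> i)"
      using assms(2)[of i] by (simp only: smooth_on_def)
    then have "continuous_on ((\<lambda>R. R $ i) ` U) (\<eta> i)" by simp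
    then have "continuous_on U (\<lambda>R. \<eta> i (R $ i))"
      by (rule continuous_on_compose2) (auto intro: continuous_intros)
    then have "\<exists>d>0. \<forall>R\<in>U. dist R p < d \<longrightarrow> dist (\<eta> i (R $ i)) (\<eta> i (p $ i)) < l\<^sub>0 + \<eta> i (p $ i)"
      unfolding continuous_on_iff using p l0[rule_format, of i] by simp
    moreover have "l\<^sub>0 + a > 0" if "dist a b < l\<^sub>0 + b" for a b :: real
      using that by (simp add: dist_real_def)
    ultimately show ?thesis by meson
  qed
  then obtain d where d: "\<And>i. d i > 0"
    "\<And>i R. R \<in> U \<Longrightarrow> dist R p < d i \<Longrightarrow> l\<^sub>0 + \<eta> i (R $ i) > 0" by metis
  obtain d0 where d0: "d0 > 0" "ball p d0 \<subseteq> U" using assms(1) p open_contains_ball by blast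
  define d1 where "d1 = Min (insert d0 (range d))"
  have d1: "d1 > 0" "d1 \<le> d0" "\<And>i. d1 \<le> d i"
    unfolding d1_def using d(1) d0(1) by (auto intro!: Min_le simp del: Min_insert)
  define V where "V = ball p d1"
  have V: "open V" "convex V" "p \<in> V" using d1(1) by (simp_all add: V_def)
  have VU: "V \<subseteq> U" using d0(2) d1(2) by (auto simp: V_def)
  have adm0: "admissible_on V \<eta> l\<^sub>0"
    unfolding admissible_on_def
  proof (intro ballI allI)
    fix R i assume R: "R \<in> V"
    then have "dist R p < d i" using d1(3)[of i] by (simp add: V_def dist_commute)
    then show "l\<^sub>0 + \<eta> i (R $ i) > 0" using d(2) R VU by blast
  qed
  have smV: "smooth_on S' f" if "smooth_on S f" "S' \<subseteq> S" for S S' and f :: "'c::real_normed_vector \<Rightarrow> real"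
    using that Ck_on_subset unfolding smooth_on_def by blast
  let ?P = "\<lambda>l (\<phi> :: 'n \<Rightarrow> real^'n \<Rightarrow> real^'n) (r :: real^'n \<Rightarrow> real^'n).
    (\<forall>i. smooth_on V (\<phi> i)) \<and> smooth_on V r \<and>
    (\<forall>R\<in>V. orthonormal_frame (\<lambda>i. \<phi> i R)) \<and>
    (\<forall>R\<in>V. \<forall>i j. j \<noteq> i \<longrightarrow> pd j (\<phi> i) R =
      (sqrt ((l + \<eta> i (R $ i)) / (l + \<eta> j (R $ j))) * \<beta> i j R) *\<^sub>R \<phi> j R) \<and>
    (\<forall>R\<in>V. \<forall>i. pd i (\<phi> i) R = - (\<Sum>k\<in>UNIV - {i}.
      (sqrt ((l + \<eta> k (R $ k)) / (l + \<eta> i (R $ i))) * \<beta> k i R) *\<^sub>R \<phi> k R)) \<and>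
    (\<forall>R\<in>V. \<forall>i. pd i r R = (H i R / sqrt (l + \<eta> i (R $ i))) *\<^sub>R \<phi> i R)"
  have frame_exists: "\<exists>\<phi> r. ?P l \<phi> r" if adm: "admissible_on V \<eta> l" for l
  proof (rule pencil_frame[where \<eta> = \<eta> and H = H and \<beta> = \<beta> and l = l, OF V(1,2) _ _ _ _ _ _ _ adm])
      show "smooth_on ((\<lambda>R. R $ i) ` V) (\<eta> i)" for i
        by (rule smV[OF assms(2)]) (use VU in auto)
      show "smooth_on V (H i)" for i by (rule smV[OF assms(3) VU])
      show "smooth_on V (\<beta> i j)" if "i \<noteq> j" for i j by (rule smV[OF assms(4)[OF that] VU])
    qed (erule assms(5,7-9)[OF subsetD[OF VU]]; assumption)+
  have "\<exists>\<phi> r. \<forall>l. admissible_on V \<eta> l \<longrightarrow> ?P l (\<phi> l) (r l)"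
    by (rule conditional_choice2) (rule frame_exists)
  then obtain \<phi> r where "\<forall>l. admissible_on V \<eta> l \<longrightarrow> ?P l (\<phi> l) (r l)"
    by (elim exE)
  note P = mp[OF spec[OF this]]
  note P1 = P[THEN conjunct1] and P2 = P[THEN conjunct2, THEN conjunct1]
    and P3 = P[THEN conjunct2, THEN conjunct2, THEN conjunct1]
    and P4 = P[THEN conjunct2, THEN conjunct2, THEN conjunct2, THEN conjunct1]
    and P5 = P[THEN conjunct2, THEN conjunct2, THEN conjunct2, THEN conjunct2, THEN conjunct1]
    and P6 = P[THEN conjunct2, THEN conjunct2, THEN conjunct2, THEN conjunct2, THEN conjunct2]
  define \<kappa> where "\<kappa> l m i R = \<beta> m i R / H i R * sqrt (l + \<eta> m (R $ m))" for l m i R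
  define h where "h l i R = H i R / sqrt (l + \<eta> i (R $ i))" for l i R
  define W where "W l m R = diagonal_operator (\<lambda>i. \<phi> l i R) (\<lambda>i. \<kappa> l m i R) m" for l m R
  have frame: "\<And>i. smooth_on V (\<phi> l i)" "smooth_on V (r l)"
    "\<And>R. R \<in> V \<Longrightarrow> orthonormal_frame (\<lambda>i. \<phi> l i R)"
    "\<And>R i. R \<in> V \<Longrightarrow> pd i (r l) R = h l i R *\<^sub>R \<phi> l i R"
    "\<And>R i. R \<in> V \<Longrightarrow> h l i R > 0"
    "\<And>R i m. R \<in> V \<Longrightarrow> i \<noteq> m \<Longrightarrow> pd i (\<phi> l m) R = \<kappa> l m i R *\<^sub>R pd i (r l) R"
    if adm: "admissible_on V \<eta> l" for l
  proof -
    show "smooth_on V (\<phi> l i)" for i using P1[OF adm] ..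
    show "smooth_on V (r l)" by (rule P2[OF adm])
    show "orthonormal_frame (\<lambda>i. \<phi> l i R)" if "R \<in> V" for R using P3[OF adm] that ..
    show dr: "pd i (r l) R = h l i R *\<^sub>R \<phi> l i R" if "R \<in> V" for R i
      unfolding h_def using P6[OF adm] that by simp
    have pos: "l + \<eta> i (R $ i) > 0" "H i R > 0" if "R \<in> V" for R i
      using adm that assms(6) VU by (auto simp: admissible_on_def)
    show "h l i R > 0" if "R \<in> V" for R i
      using pos[OF that] by (simp add: h_def)
    show "pd i (\<phi> l m) R = \<kappa> l m i R *\<^sub>R pd i (r l) R" if R: "R \<in> V" and im: "i \<noteq> m" for R i m
    proof -
      have "pd i (\<phi> l m) R = (sqrt ((l + \<eta> m (R $ m)) / (l + \<eta> i (R $ i))) * \<beta> m i R) *\<^sub>R \<phi> l i R"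
        using P4[OF adm] R im by simp
      also have "sqrt ((l + \<eta> m (R $ m)) / (l + \<eta> i (R $ i))) * \<beta> m i R = \<kappa> l m i R * h l i R"
        using pos(2)[OF R, of i] by (simp add: \<kappa>_def h_def real_sqrt_divide)
      finally show ?thesis by (simp add: dr[OF R])
    qed
  qed
  have h2: "(h l i R)\<^sup>2 = (H i R)\<^sup>2 / (l + \<eta> i (R $ i))" if "admissible_on V \<eta> l" "R \<in> V" for l i R
    using that by (simp add: h_def power_divide admissible_on_def less_imp_le)
  have coordinates: "in_coordinates (r l) R (W l m R) v = (\<chi> i. if i = m then 0 else \<kappa> l m i R * v $ i)"
    if "admissible_on V \<eta> l" "R \<in> V" for l m R v
    unfolding W_def
    by (rule orthogonal_frame_geometry(6)[where \<kappa> = "\<kappa> l" and h = "h l", OF V(1) frame[OF that(1)] that(2)])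
  show "\<exists>V. open V \<and> p \<in> V \<and> V \<subseteq> U \<and> admissible_on V \<eta> l\<^sub>0 \<and>
        (\<exists>(\<phi> :: real \<Rightarrow> 'n \<Rightarrow> real^'n \<Rightarrow> real^'n)
          (r :: real \<Rightarrow> real^'n \<Rightarrow> real^'n)
          (W :: real \<Rightarrow> 'n \<Rightarrow> real^'n \<Rightarrow> (real^'n \<Rightarrow> real^'n)).
          (\<forall>l. admissible_on V \<eta> l \<longrightarrow>
             (\<forall>i. smooth_on V (\<phi> l i)) \<and>
             (\<forall>R\<in>V. orthonormal_frame (\<lambda>i. \<phi> l i R)) \<and>
             (\<forall>R\<in>V. \<forall>i j. j \<noteq> i \<longrightarrow>
                pd j (\<phi> l i) R =
                  (sqrt ((l + \<eta> i (R $ i)) / (l + \<eta> j (R $ j))) * \<beta> i j R) *\<^sub>R \<phi> l j R) \<and>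
             (\<forall>R\<in>V. \<forall>i.
                pd i (\<phi> l i) R =
                  - (\<Sum>k\<in>UNIV - {i}.
                      (sqrt ((l + \<eta> k (R $ k)) / (l + \<eta> i (R $ i))) * \<beta> k i R) *\<^sub>R \<phi> l k R)) \<and>
             (\<forall>R\<in>V. \<forall>i.
                pd i (r l) R = (H i R / sqrt (l + \<eta> i (R $ i))) *\<^sub>R \<phi> l i R) \<and>
             orthogonal_coordinate_system_on V (r l) \<and>
             (\<forall>R\<in>V. \<forall>i j.
                metric_of (r l) R i j = (if i = j then (H i R)\<^sup>2 / (l + \<eta> i (R $ i)) else 0)) \<and>
             flat_metric_on V (\<lambda>R i j. if i = j then (H i R)\<^sup>2 / (l + \<eta> i (R $ i)) else 0) \<and>
             (\<forall>m. unit_normal_on V (r l) m (\<phi> l m)) \<and>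
             (\<forall>R\<in>V. \<forall>m.
                (\<forall>i. i \<noteq> m \<longrightarrow>
                   pd i (\<phi> l m) R =
                     (\<beta> m i R / H i R * sqrt (l + \<eta> m (R $ m))) *\<^sub>R pd i (r l) R) \<and>
                weingarten_operator (r l) (\<phi> l m) m R (W l m R) \<and>
                curvature_line_coordinates_at (r l) m R (W l m R)
                  (\<lambda>i. \<beta> m i R / H i R * sqrt (l + \<eta> m (R $ m))))) \<and>
          (\<forall>l l' m c. admissible_on V \<eta> l \<longrightarrow> admissible_on V \<eta> l' \<longrightarrow>
             (\<exists>s>0. \<forall>R\<in>V. R $ m = c \<longrightarrow>
                (\<forall>v. v $ m = 0 \<longrightarrow>
                   in_coordinates (r l') R (W l' m R) v =
                     s *\<^sub>R in_coordinates (r l) R (W l m R) v))))"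
  proof (rule exI[of _ V], intro conjI V(1,3) VU adm0,
      rule exI[of _ \<phi>], rule exI[of _ r], rule exI[of _ W], rule conjI, goal_cases)
    case 1
    show ?case
    proof (intro allI impI, goal_cases)
      case (1 l)
      note adm = 1
      note geometry = orthogonal_frame_geometry[where \<kappa> = "\<kappa> l" and h = "h l", OF V(1) frame[OF adm]]
      show ?case
      proof (intro conjI, goal_cases)
        case 1
        show ?case by (rule P1[OF adm])
      next
        case 2
        show ?case by (rule P3[OF adm])
      next
        case 3
        show ?case by (rule P4[OF adm])
      next
        case 4
        show ?case by (rule P5[OF adm])
      next
        case 5
        show ?case by (rule P6[OF adm])
      next
        case 6
        show ?case by (rule geometry(1))
      next
        case 7
        show ?case using geometry(2) h2[OF adm] by simp
      next
        case 8
        have "coordinate_system_on V (r l)"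
          using geometry(1) by (simp add: orthogonal_coordinate_system_on_def)
        moreover have "\<forall>R\<in>V. \<forall>i j. (if i = j then (H i R)\<^sup>2 / (l + \<eta> i (R $ i)) else 0) = metric_of (r l) R i j"
          using geometry(2) h2[OF adm] by simp
        ultimately show ?case
          unfolding flat_metric_on_def using V(1) by blast
      next
        case 9
        show ?case using geometry(3) by blast
      next
        case 10
        show ?case
          using frame(6)[OF adm] geometry(4,5) unfolding W_def \<kappa>_def by simp
      qed
    qed
  next
    case 2
    show ?case
    proof (intro allI impI, goal_cases)
      case (1 l l' m c)
      show ?case
      \<comment> \<open>If the hypersurface misses \<open>V\<close>, then \<open>l + \<eta> m c\<close> need not be positive, and any factor will do.\<close>
      proof (cases "\<exists>R\<in>V. R $ m = c")
        case True
        then have pos: "l + \<eta> m c > 0" "l' + \<eta> m c > 0"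
          using 1 by (auto simp: admissible_on_def)
        define s where "s = sqrt (l' + \<eta> m c) / sqrt (l + \<eta> m c)"
        have "\<kappa> l' m i R = s * \<kappa> l m i R" if "R $ m = c" for i R
          using that pos by (simp add: \<kappa>_def s_def)
        then have "in_coordinates (r l') R (W l' m R) v = s *\<^sub>R in_coordinates (r l) R (W l m R) v"
          if "R \<in> V" "R $ m = c" for R v
          using that by (simp add: coordinates 1 vec_eq_iff)
        moreover have "s > 0" using pos by (simp add: s_def)
        ultimately show ?thesis by blast
      next
        case False
        then show ?thesis by (intro exI[of _ 1]) auto
      qed
    qed
  qed
qed

end
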